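(* For every integer $k\ge 0$, the class of all semi-complete digraphs with path-width at most $k$ is a well-quasi-order under minor containment. That is, for every infinite sequence $G_1,G_2,\ldots$ of semi-complete digraphs each with path-width at most $k$, there exist $j>i\ge 1$ such that $G_i$ is a minor of $G_j$.
   Context: All digraphs are finite (in general loops and parallel edges are allowed); an edge $uv$ has tail $u$ and head $v$. A digraph is simple if it is loopless and there is at most one edge $uv$ for every ordered pair of distinct vertices $u,v$ (so $uv$ and $vu$ may both be edges). A simple digraph $G$ is semi-complete if for all distinct $u,v\in V(G)$ at least one of $uv, vu$ is an edge. A digraph is strongly-connected if it is non-null and has a directed path from $u$ to $v$ for all vertices $u,v$. Path-width: a path-decomposition of a digraph $G$ is a sequence $P=(W_1,\ldots,W_r)$ with $r\ge 1$ and $\bigcup_{1\le i\le r}W_i=V(G)$ such that $W_h\cap W_j\subseteq W_i$ whenever $1\le h<i<j\le r$, and for every edge $uv\in E(G)$ there exist $i,j$ with $1\le i\le j\le r$ such that $u\in W_j$ and $v\in W_i$. Its width is $\max_{1\le i\le r}|W_i|-1$. $G$ has path-width at most $k$ if it has a path-decomposition of width at most $k$. Minors: a digraph $H$ is a minor of a digraph $G$ if $H$ can be obtained from a subdigraph of $G$ by repeatedly contracting a strongly-connected subdigraph to a vertex. Equivalently, there is a minor mapping from $H$ to $G$, i.e. a mapping $\phi$ defined on $V(H)$ such that: (i) for every $v\in V(H)$, $\phi(v)$ is a non-null strongly-connected subdigraph of $G$; (ii) $\phi(u)$ and $\phi(v)$ are vertex-disjoint for distinct $u,v\in V(H)$;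 (iii) for all $u,v\in V(H)$ (not necessarily distinct), if there are $n$ edges of $H$ with tail $u$ and head $v$, then there are at least $n$ edges of $G$ with tail in $V(\phi(u))$ and head in $V(\phi(v))$ that are not contained in $E(\phi(x))$ for any $x\in V(H)$. *)

theory Defs
  imports "Graph_Theory.Digraph_Isomorphism"
begin

text \<open>A \<^emph>\<open>simple\<close> digraph (finite, loopless, at most one arc per ordered pair of vertices)
  is an instance of the library locale \<^locale>\<open>digraph\<close>; the null digraph is allowed.\<close>

locale semicomplete_digraph = digraph +
  assumes semicomplete: "\<lbrakk>u \<in> verts G; v \<in> verts G; u \<noteq> v\<rbrakk> \<Longrightarrow> u \<rightarrow>\<^bsub>G\<^esub> v \<or> v \<rightarrow>\<^bsub>G\<^esub> u"


section \<open>Path-width\<close>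

definition path_decomposition :: "('a, 'b) pre_digraph \<Rightarrow> 'a set list \<Rightarrow> bool" where
  "path_decomposition G Ws \<longleftrightarrow>
     Ws \<noteq> [] \<and>
     \<Union> (set Ws) = verts G \<and>
     (\<forall>h i j. h < i \<and> i < j \<and> j < length Ws \<longrightarrow> Ws ! h \<inter> Ws ! j \<subseteq> Ws ! i) \<and>
     (\<forall>e \<in> arcs G. \<exists>i j. i \<le> j \<and> j < length Ws \<and> tail G e \<in> Ws ! j \<and> head G e \<in> Ws ! i)"

text \<open>The width is an integer, since it is \<open>-1\<close> for the null digraph with empty bags.\<close>

definition decomposition_width :: "'a set list \<Rightarrow> int" where
  "decomposition_width Ws = int (Max (card ` set Ws)) - 1"

definition path_width_at_most :: "('a, 'b) pre_digraph \<Rightarrow> nat \<Rightarrow> bool" where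
  "path_width_at_most G k \<longleftrightarrow>
     (\<exists>Ws. path_decomposition G Ws \<and> decomposition_width Ws \<le> int k)"


section \<open>Minors\<close>

text \<open>Contracting \<open>S\<close> identifies its vertices to the single vertex \<open>s\<close> (to be chosen in
  \<open>verts S\<close>) and deletes the arcs of \<open>S\<close>. Arcs outside \<open>S\<close> with both ends in
  \<open>verts S\<close> survive as loops at \<open>s\<close>, and parallel arcs are kept.\<close>

definition contract ::
    "('a, 'b) pre_digraph \<Rightarrow> ('a, 'b) pre_digraph \<Rightarrow> 'a \<Rightarrow> ('a, 'b) pre_digraph" where
  "contract G S s = \<lparr>
     verts = insert s (verts G - verts S),
     arcs = arcs G - arcs S,
     tail = (\<lambda>e. if tail G e \<in> verts S then s else tail G e),
     head = (\<lambda>e. if head G e \<in> verts S then s else head G e) \<rparr>"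

inductive contracts_to :: "('a, 'b) pre_digraph \<Rightarrow> ('a, 'b) pre_digraph \<Rightarrow> bool"
  for G :: "('a, 'b) pre_digraph" where
  refl: "contracts_to G G"
| step: "\<lbrakk>contracts_to G G'; subgraph S G'; strongly_connected S; s \<in> verts S\<rbrakk>
    \<Longrightarrow> contracts_to G (contract G' S s)"

definition minor :: "('c, 'd) pre_digraph \<Rightarrow> ('a, 'b) pre_digraph \<Rightarrow> bool" where
  "minor H G \<longleftrightarrow>
     (\<exists>G\<^sub>0 G\<^sub>1. subgraph G\<^sub>0 G \<and> contracts_to G\<^sub>0 G\<^sub>1 \<and> digraph_iso G\<^sub>1 H)"

end

theory Submission
  imports Defs "HOL-Library.Sublist" "HOL-Library.Ramsey"
begin

text \<open>A separation is coded as a function \<open>s\<close> with values 0 (left), 1 (middle), 2 (right) such that no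
  edge leads from value 0 to value 2; its order is the number of vertices of value 1. A
  path-decomposition becomes a chain of separations in which every vertex runs through 2, 1, 0, one
  step at a time. By uncrossing, the chain can be chosen linked: two members of equal order with no
  smaller one between them are joined by that many disjoint paths, by Menger's theorem. Along these
  paths the middle vertices of all members are labelled consistently, and the chain becomes a word
  over a finite alphabet whose letters raise or lower the order by one, i.e. a Dyck word of bounded
  height. Iterating Higman's lemma, one of the words arises from an earlier one by inserting Dyck
  words. Each inserted word is bridged by the disjoint paths. An induced
  path of length at least two is strongly connected, since in a semicomplete digraph its last vertex
  dominates its first one; recording in the letters the parities of positions along the paths
  excludes length one. The unions of these paths are the branch sets of a minor.\<close>


section \<open>Higman's lemma and Dyck words\<close>

text \<open>Letters record only what happens in the middle, yet every arc of the smaller digraph has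
  to be realised. Suppose the ends of an arc \<open>uv\<close> are never in the middle together.
  Then \<open>v\<close> has been left behind before \<open>u\<close> enters, and the larger digraph
  has vertices of the two branch sets on opposite sides of one separation. The arc from left to
  right is missing there, so semicompleteness supplies the arc from right to left, and nothing about
  such pairs has to be recorded. Plain subsequence embedding would not suffice: an inserted factor
  must return to its initial order without falling below it, for otherwise there need not be enough
  disjoint paths through it. Being a Dyck word expresses exactly this. Moreover the two ends of an
  inserted factor must carry the same information, which is why a letter describes both separations
  of its step.\<close>

definition almost_full_on :: "('a \<Rightarrow> 'a \<Rightarrow> bool) \<Rightarrow> 'a set \<Rightarrow> bool" where
  "almost_full_on P A \<longleftrightarrow> (\<forall>f :: nat \<Rightarrow> 'a. (\<forall>i. f i \<in> A) \<longrightarrow> (\<exists>i j. i < j \<and> P (f i) (f j)))"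

lemma almost_full_onD:
  fixes f :: "nat \<Rightarrow> 'a"
  assumes "almost_full_on P A" "\<And>i. f i \<in> A"
  obtains i j where "i < j" "P (f i) (f j)"
  using assms unfolding almost_full_on_def by blast

text \<open>Ramsey's theorem for pairs, coloured by whether \<open>P\<close> relates the earlier
  term to the later one: an infinite homogeneous set of the negative colour would contradict
  almost-fullness.\<close>

lemma almost_full_on_homogeneous:
  fixes f :: "nat \<Rightarrow> 'a"
  assumes af: "almost_full_on P A" and f: "\<And>i. f i \<in> A"
  shows "\<exists>r :: nat \<Rightarrow> nat. strict_mono r \<and> (\<forall>i j. i < j \<longrightarrow> P (f (r i)) (f (r j)))"
proof -
  define c :: "nat set \<Rightarrow> nat" where "c X = (if P (f (Min X)) (f (Max X)) then 0 else 1)" for X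
  have "\<exists>Y t. Y \<subseteq> UNIV \<and> infinite Y \<and> t < 2 \<and> (\<forall>x\<in>Y. \<forall>y\<in>Y. x \<noteq> y \<longrightarrow> c {x, y} = t)"
    by (rule Ramsey2[of UNIV c 2]) (simp_all add: c_def)
  then obtain Y t where Y: "infinite Y" and cY: "\<forall>x\<in>Y. \<forall>y\<in>Y. x \<noteq> y \<longrightarrow> c {x, y} = t"
    by (elim exE conjE)
  have t: "c {x, y} = t" if "x \<in> Y" "y \<in> Y" "x \<noteq> y" for x y
    using cY that by simp
  define r where "r = enumerate Y"
  have r: "strict_mono r" and rY: "\<And>i. r i \<in> Y"
    using Y by (auto simp: r_def strict_mono_enumerate enumerate_in_set)
  have c: "c {r i, r j} = (if P (f (r i)) (f (r j)) then 0 else 1)" if "i < j" for i j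
    using strict_monoD[OF r that] by (simp add: c_def)
  obtain i j where ij: "i < j" "P (f (r i)) (f (r j))"
    using almost_full_onD[OF af, of "f \<circ> r"] f by auto
  have "t = 0"
    using t[OF rY rY, of i j] c[OF ij(1)] ij strict_monoD[OF r ij(1)] by auto
  then have "P (f (r i)) (f (r j))" if "i < j" for i j
    using t[OF rY rY, of i j] c[OF that] strict_monoD[OF r that] by (auto split: if_splits)
  with r show ?thesis by blast
qed

lemma almost_full_on_finite_Times:
  assumes fin: "finite A" and af: "almost_full_on P B"
  shows "almost_full_on (\<lambda>x y. fst x = fst y \<and> P (snd x) (snd y)) (A \<times> B)"
  unfolding almost_full_on_def
proof (intro allI impI)
  fix f :: "nat \<Rightarrow> 'a \<times> 'b"
  assume f: "\<forall>i. f i \<in> A \<times> B"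
  have "finite (range (\<lambda>i. fst (f i)))"
    by (rule finite_subset[OF _ fin]) (use f in \<open>auto simp: mem_Times_iff\<close>)
  then obtain k where k: "infinite {i \<in> UNIV. fst (f i) = fst (f k)}"
    using pigeonhole_infinite[of UNIV "\<lambda>i. fst (f i)"] by auto
  define r where "r = enumerate {i. fst (f i) = fst (f k)}"
  have r: "strict_mono r" and fst: "fst (f (r i)) = fst (f k)" for i
    using k enumerate_in_set[of "{i. fst (f i) = fst (f k)}" i]
    by (auto simp: r_def strict_mono_enumerate)
  obtain i j where "i < j" "P (snd (f (r i))) (snd (f (r j)))"
    using almost_full_onD[OF af, of "\<lambda>i. snd (f (r i))"] f by (metis mem_Times_iff)
  then show "\<exists>i j. i < j \<and> fst (f i) = fst (f j) \<and> P (snd (f i)) (snd (f j))"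
    using fst strict_monoD[OF r] by metis
qed

text \<open>Nash-Williams' minimal bad sequence argument.\<close>

theorem Higman:
  assumes af: "almost_full_on P A"
  shows "almost_full_on (list_emb P) (lists A)"
proof (rule ccontr)
  define bad where "bad f \<longleftrightarrow> (\<forall>i. f i \<in> lists A) \<and> (\<forall>i j. i < j \<longrightarrow> \<not> list_emb P (f i) (f j))"
    for f :: "nat \<Rightarrow> 'a list"
  assume "\<not> ?thesis"
  then obtain f0 where f0: "bad f0" unfolding almost_full_on_def bad_def by blast
  \<comment> \<open>\<open>nxt n f\<close> keeps the first \<open>n\<close> terms of the bad
    sequence \<open>f\<close> and makes the next term as short as possible. \<open>F\<close>
    iterates this, and \<open>m\<close> below is the diagonal limit.\<close>
  define nxt where "nxt n f = arg_min (\<lambda>g. length (g n)) (\<lambda>g. bad g \<and> (\<forall>i<n. g i = f i))" for n f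
  have nxt: "bad (nxt n f)" "\<And>i. i < n \<Longrightarrow> nxt n f i = f i"
    "\<And>g. bad g \<Longrightarrow> (\<And>i. i < n \<Longrightarrow> g i = f i) \<Longrightarrow> length (nxt n f n) \<le> length (g n)"
    if "bad f" for n f
    using arg_min_natI[of "\<lambda>g. bad g \<and> (\<forall>i<n. g i = f i)" f "\<lambda>g. length (g n)"]
      arg_min_nat_le[of "\<lambda>g. bad g \<and> (\<forall>i<n. g i = f i)" _ "\<lambda>g. length (g n)"] that
    unfolding nxt_def by auto
  define F where "F = rec_nat f0 nxt"
  have F_Suc: "F (Suc n) = nxt n (F n)" for n by (simp add: F_def)
  have bad: "bad (F n)" for n by (induction n) (simp_all add: F_Suc nxt(1) f0, simp add: F_def f0)
  have stable: "i < m \<Longrightarrow> F (m + d) i = F m i" for i m d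
    by (induction d) (simp_all add: F_Suc nxt(2)[OF bad])
  define m where "m n = F (Suc n) n" for n
  have m: "F n i = m i" if "i < n" for n i
    using stable[of i "Suc i" "n - Suc i"] that by (simp add: m_def)
  have m_lists: "m i \<in> lists A" for i
    using bad unfolding m_def bad_def by blast
  have m_bad: "\<not> list_emb P (m i) (m j)" if "i < j" for i j
    using bad[of "Suc j"] m[of i "Suc j"] m[of j "Suc j"] that unfolding bad_def by fastforce
  have m_min: "length (m n) \<le> length (g n)" if "bad g" "\<And>i. i < n \<Longrightarrow> g i = m i" for g n
    using nxt(3)[OF bad that(1), of n n] that(2) m by (simp add: m_def F_Suc)
  have ne: "m i \<noteq> []" for i
    using m_bad[of i "Suc i"] by auto
  then have hd: "hd (m i) \<in> A" and tl: "tl (m i) \<in> lists A" for i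
    using m_lists[of i] by (cases "m i"; fastforce)+
  obtain r :: "nat \<Rightarrow> nat" where r: "strict_mono r"
    and hdP: "\<And>i j. i < j \<Longrightarrow> P (hd (m (r i))) (hd (m (r j)))"
    using almost_full_on_homogeneous[OF af, of "\<lambda>i. hd (m i)"] hd by auto
  \<comment> \<open>The tails of the words at positions \<open>r i\<close>, whose heads are pairwise
    related, are spliced after the first \<open>r 0\<close> words. The minimality of
    \<open>m (r 0)\<close> prevents the result from being bad.\<close>
  define g where "g i = (if i < r 0 then m i else tl (m (r (i - r 0))))" for i
  have "\<not> length (m (r 0)) \<le> length (g (r 0))"
    using ne[of "r 0"] by (cases "m (r 0)") (auto simp: g_def)
  then have "\<not> bad g" using m_min[of g "r 0"] by (auto simp: g_def)
  then obtain i j where ij: "i < j" and emb: "list_emb P (g i) (g j)"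
    unfolding bad_def g_def using m_lists tl by (auto split: if_splits)
  have lift: "list_emb P x (m k)" if "list_emb P x (tl (m k))" for x k
    using that ne[of k] by (cases "m k") auto
  consider "j < r 0" | "i < r 0" "j \<ge> r 0" | "i \<ge> r 0" by linarith
  then show False
  proof cases
    case 1
    then show ?thesis using emb m_bad ij by (auto simp: g_def)
  next
    case 2
    then have "i < r (j - r 0)"
      using strict_mono_less_eq[OF r, of 0 "j - r 0"] by linarith
    with 2 show ?thesis using emb m_bad lift by (auto simp: g_def)
  next
    case 3
    define a b where "a = i - r 0" and "b = j - r 0"
    have ab: "a < b" using 3 ij by (auto simp: a_def b_def)
    have "list_emb P (tl (m (r a))) (tl (m (r b)))"
      using 3 ij emb by (auto simp: g_def a_def b_def)
    then have "list_emb P (hd (m (r a)) # tl (m (r a))) (hd (m (r b)) # tl (m (r b)))"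
      using hdP[OF ab] by blast
    then show ?thesis using m_bad strict_monoD[OF r ab] ne by simp
  qed
qed

section \<open>Dyck words of bounded height and their embeddings\<close>

inductive dyck :: "('a \<Rightarrow> bool) \<Rightarrow> nat \<Rightarrow> 'a list \<Rightarrow> bool" for up where
  dyck_Nil: "dyck up h []"
| dyck_block: "dyck up h u \<Longrightarrow> dyck up (Suc h) v \<Longrightarrow> up x \<Longrightarrow> \<not> up y \<Longrightarrow> dyck up (Suc h) (x # u @ y # v)"

lemma dyck_mono: "dyck up h w \<Longrightarrow> h \<le> h' \<Longrightarrow> dyck up h' w"
proof (induction arbitrary: h' rule: dyck.induct)
  case (dyck_block h u v x y)
  then show ?case by (cases h') (auto intro: dyck.dyck_block)
qed (rule dyck_Nil)

lemma dyck_append_same: "dyck up h u \<Longrightarrow> dyck up h v \<Longrightarrow> dyck up h (u @ v)"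
  by (induction rule: dyck.induct) (auto intro: dyck_block)

lemma dyck_append: "dyck up h u \<Longrightarrow> dyck up h' v \<Longrightarrow> dyck up (max h h') (u @ v)"
  by (meson dyck_append_same dyck_mono max.cobounded1 max.cobounded2)

lemma dyck_blocks:
  assumes "dyck up (Suc h) w"
  obtains bs where "w = concat (map (\<lambda>((x, y), u). x # u @ [y]) bs)"
    "\<And>x y u. ((x, y), u) \<in> set bs \<Longrightarrow> up x \<and> \<not> up y \<and> dyck up h u"
proof -
  have "\<exists>bs. w = concat (map (\<lambda>((x, y), u). x # u @ [y]) bs) \<and>
    (\<forall>x y u. ((x, y), u) \<in> set bs \<longrightarrow> up x \<and> \<not> up y \<and> dyck up h u)"
    using assms
  proof (induction "Suc h" w rule: dyck.induct)
    case (dyck_block u v x y)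
    then obtain bs where bs: "v = concat (map (\<lambda>((x, y), u). x # u @ [y]) bs)"
      "\<forall>x y u. ((x, y), u) \<in> set bs \<longrightarrow> up x \<and> \<not> up y \<and> dyck up h u" by blast
    show ?case
      by (rule exI[of _ "((x, y), u) # bs"]) (use bs dyck_block in auto)
  qed (auto intro: exI[of _ "[]"])
  then show ?thesis using that by blast
qed

text \<open>A subsequence embedding in which every skipped stretch, at the ends as well, is itself a
  Dyck word. The heights of these stretches are left free, so the relation is the same at every
  stage of the induction on the height.\<close>

inductive dyck_emb :: "('a \<Rightarrow> bool) \<Rightarrow> 'a list \<Rightarrow> 'a list \<Rightarrow> bool" for up where
  dyck_emb_Nil: "dyck up h g \<Longrightarrow> dyck_emb up [] g"
| dyck_emb_Cons: "dyck up h g \<Longrightarrow> dyck_emb up w w' \<Longrightarrow> dyck_emb up (x # w) (g @ x # w')"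

lemma dyck_emb_prepend: "dyck_emb up w w' \<Longrightarrow> dyck up h g \<Longrightarrow> dyck_emb up w (g @ w')"
proof (induction rule: dyck_emb.induct)
  case (dyck_emb_Nil h' g')
  then show ?case by (blast intro: dyck_emb.dyck_emb_Nil dyck_append)
next
  case (dyck_emb_Cons h' g' w w' x)
  then show ?case
    using dyck_emb.dyck_emb_Cons[OF dyck_append[of up h g h' g'], of w w' x] by simp
qed

lemma dyck_emb_append: "dyck_emb up u u' \<Longrightarrow> dyck_emb up v v' \<Longrightarrow> dyck_emb up (u @ v) (u' @ v')"
proof (induction rule: dyck_emb.induct)
  case (dyck_emb_Nil h g)
  then show ?case by (simp add: dyck_emb_prepend)
next
  case (dyck_emb_Cons h g w w' x)
  then show ?case using dyck_emb.dyck_emb_Cons[of up h g "w @ v" "w' @ v'" x] by simp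
qed

lemma dyck_emb_singleton: "dyck_emb up [x] [x]"
  using dyck_emb_Cons[OF dyck_Nil dyck_emb_Nil[OF dyck_Nil], of up x] by simp

text \<open>Induction on the height. A word of height \<open>Suc h\<close> is a list of blocks, each
  consisting of two letters of a finite set around a word of height \<open>h\<close>. The induction
  hypothesis makes the blocks almost full, and Higman's lemma lifts this to lists. A block skipped
  by the list embedding is an inserted Dyck word; a matched block is embedded through its
  interior.\<close>

theorem almost_full_on_dyck_emb:
  assumes "finite A"
  shows "almost_full_on (dyck_emb up) {w. dyck up h w \<and> set w \<subseteq> A}"
proof (induction h)
  case 0
  have "w = []" if "dyck up 0 w" for w
    using that by cases auto
  moreover have "dyck_emb up [] []" by (rule dyck_emb_Nil[OF dyck_Nil])
  ultimately show ?case unfolding almost_full_on_def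
    by (metis (mono_tags, lifting) lessI mem_Collect_eq)
next
  case (Suc h)
  define Q :: "('a \<times> 'a) \<times> 'a list \<Rightarrow> _" where "Q = (\<lambda>b b'. fst b = fst b' \<and> dyck_emb up (snd b) (snd b'))"
  let ?blk = "\<lambda>((x, y), u). x # u @ [y]"
  let ?B = "(A \<times> A) \<times> {w. dyck up h w \<and> set w \<subseteq> A}"
  let ?C = "{b \<in> ?B. up (fst (fst b)) \<and> \<not> up (snd (fst b))}"
  have afB: "almost_full_on Q ?B"
    unfolding Q_def by (rule almost_full_on_finite_Times[OF _ Suc.IH]) (use assms in simp)
  then have "almost_full_on Q ?C"
    unfolding almost_full_on_def by blast
  then have af: "almost_full_on (list_emb Q) (lists ?C)"
    by (rule Higman)
  have emb: "dyck_emb up (concat (map ?blk bs)) (concat (map ?blk bs'))"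
    if "list_emb Q bs bs'" "bs \<in> lists ?C" "bs' \<in> lists ?C" for bs bs'
    using that
  proof (induction rule: list_emb.induct)
    case (list_emb_Nil ys)
    have "dyck up (Suc h) (concat (map ?blk ys))"
      using list_emb_Nil(2)
    proof (induction ys)
      case (Cons b ys)
      obtain x y u where b: "b = ((x, y), u)" by (metis surj_pair)
      show ?case using Cons dyck_block[of up h u "concat (map ?blk ys)" x y] by (auto simp: b)
    qed (auto intro: dyck_Nil)
    then show ?case by (auto intro: dyck_emb_Nil)
  next
    case (list_emb_Cons xs ys b)
    obtain x y u where b: "b = ((x, y), u)" by (metis surj_pair)
    have "dyck up (Suc h) (?blk b)"
      using list_emb_Cons.prems dyck_block[OF _ dyck_Nil, of up h u x y] by (auto simp: b)
    then have "dyck_emb up (concat (map ?blk xs)) (?blk b @ concat (map ?blk ys))"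
      using list_emb_Cons by (intro dyck_emb_prepend) auto
    then show ?case by simp
  next
    case (list_emb_Cons2 b b' xs ys)
    obtain x y u where b: "b = ((x, y), u)" by (metis surj_pair)
    obtain u' where b': "b' = ((x, y), u')" and u: "dyck_emb up u u'"
      using list_emb_Cons2(1) by (cases b') (auto simp: Q_def b)
    have "dyck_emb up ([x] @ u @ [y]) ([x] @ u' @ [y])"
      by (intro dyck_emb_append dyck_emb_singleton u)
    then show ?case
      using dyck_emb_append[of up "?blk b" "?blk b'"] list_emb_Cons2 by (auto simp: b b')
  qed
  show ?case unfolding almost_full_on_def
  proof (intro allI impI)
    fix f :: "nat \<Rightarrow> 'a list"
    assume f: "\<forall>i. f i \<in> {w. dyck up (Suc h) w \<and> set w \<subseteq> A}"
    have "\<exists>bs. f i = concat (map ?blk bs) \<and> bs \<in> lists ?C" for i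
    proof -
      obtain bs where bs: "f i = concat (map ?blk bs)"
        "\<And>x y u. ((x, y), u) \<in> set bs \<Longrightarrow> up x \<and> \<not> up y \<and> dyck up h u"
        using dyck_blocks[of up h "f i"] f by blast
      have "b \<in> ?C" if "b \<in> set bs" for b
      proof -
        obtain x y u where b: "b = ((x, y), u)" by (metis surj_pair)
        have "set (?blk b) \<subseteq> set (f i)" using that by (auto simp: bs(1))
        then show ?thesis using bs(2)[of x y u] that f by (fastforce simp: b)
      qed
      with bs(1) show ?thesis by blast
    qed
    then have "\<exists>bs. \<forall>i. f i = concat (map ?blk (bs i)) \<and> bs i \<in> lists ?C"
      by (intro choice allI)
    then obtain bs where bs: "\<And>i. f i = concat (map ?blk (bs i))" "\<And>i. bs i \<in> lists ?C"
      by (elim exE) simp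
    obtain i j where "i < j" "list_emb Q (bs i) (bs j)"
      using almost_full_onD[OF af, of bs] bs(2) by blast
    then show "\<exists>i j. i < j \<and> dyck_emb up (f i) (f j)"
      using emb[OF _ bs(2) bs(2)] unfolding bs(1) by blast
  qed
qed

text \<open>Letter \<open>i\<close> of \<open>w\<close> is matched with position
  \<open>\<beta> i\<close> of \<open>w'\<close>, and the stretch inserted before it occupies the
  positions from \<open>\<alpha> i\<close> up to but excluding \<open>\<beta> i\<close>. The index
  \<open>length w\<close> accounts for the stretch after the last letter.\<close>

lemma dyck_emb_positions:
  assumes "dyck_emb up w w'"
  shows "\<exists>\<alpha> \<beta> :: nat \<Rightarrow> nat. \<alpha> 0 = 0 \<and> \<beta> (length w) = length w' \<and>
    (\<forall>i < length w. \<alpha> (Suc i) = Suc (\<beta> i) \<and> w ! i = w' ! \<beta> i) \<and>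
    (\<forall>i \<le> length w. \<alpha> i \<le> \<beta> i \<and> \<beta> i \<le> length w' \<and> (\<exists>h. dyck up h (take (\<beta> i - \<alpha> i) (drop (\<alpha> i) w'))))"
  using assms
proof (induction rule: dyck_emb.induct)
  case (dyck_emb_Nil h g)
  show ?case
    by (rule exI[of _ "\<lambda>_. 0"], rule exI[of _ "\<lambda>_. length g"]) (use dyck_emb_Nil in auto)
next
  case (dyck_emb_Cons h g w w' x)
  then obtain \<alpha> \<beta> :: "nat \<Rightarrow> nat" where ab: "\<alpha> 0 = 0" "\<beta> (length w) = length w'"
    "\<And>i. i < length w \<Longrightarrow> \<alpha> (Suc i) = Suc (\<beta> i) \<and> w ! i = w' ! \<beta> i"
    "\<And>i. i \<le> length w \<Longrightarrow> \<alpha> i \<le> \<beta> i \<and> \<beta> i \<le> length w' \<and> (\<exists>h. dyck up h (take (\<beta> i - \<alpha> i) (drop (\<alpha> i) w')))"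
    by blast
  define \<alpha>' where "\<alpha>' i = (case i of 0 \<Rightarrow> 0 | Suc i \<Rightarrow> length g + 1 + \<alpha> i)" for i
  define \<beta>' where "\<beta>' i = (case i of 0 \<Rightarrow> length g | Suc i \<Rightarrow> length g + 1 + \<beta> i)" for i
  show ?case
  proof (rule exI[of _ \<alpha>'], rule exI[of _ \<beta>'], intro conjI allI impI)
    show "\<alpha>' 0 = 0" by (simp add: \<alpha>'_def)
    show "\<beta>' (length (x # w)) = length (g @ x # w')" using ab by (simp add: \<beta>'_def)
    fix i
    show "\<alpha>' (Suc i) = Suc (\<beta>' i)" "(x # w) ! i = (g @ x # w') ! \<beta>' i" if "i < length (x # w)"
      using ab that by (auto simp: \<alpha>'_def \<beta>'_def nth_append split: nat.splits)
    show "\<alpha>' i \<le> \<beta>' i" "\<beta>' i \<le> length (g @ x # w')"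
      "\<exists>h. dyck up h (take (\<beta>' i - \<alpha>' i) (drop (\<alpha>' i) (g @ x # w')))" if "i \<le> length (x # w)"
      using ab(4) dyck_emb_Cons(1) that by (auto simp: \<alpha>'_def \<beta>'_def split: nat.splits)
  qed
qed

text \<open>This is what allows an inserted factor to be bridged by paths: with \<open>l\<close> as
  the order before each letter, the order at the start is the smallest one on the way and is
  attained again at the end. The clause \<open>l i > 0\<close> guards the truncated
  subtraction.\<close>

lemma dyck_levels:
  fixes l :: "nat \<Rightarrow> nat"
  assumes up: "\<And>i. i < n \<Longrightarrow> l (Suc i) = (if up (w i) then l i + 1 else l i - 1) \<and> (\<not> up (w i) \<longrightarrow> l i > 0)"
  shows "dyck up h (map w [p..<q]) \<Longrightarrow> p \<le> q \<Longrightarrow> q \<le> n \<Longrightarrow> l p = l q \<and> (\<forall>r. p \<le> r \<and> r \<le> q \<longrightarrow> l p \<le> l r)"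
proof (induction h "map w [p..<q]" arbitrary: p q rule: dyck.induct)
  case (dyck_Nil h)
  then show ?case by auto
next
  case (dyck_block h u v x y)
  define b where "b = p + Suc (length u)"
  have len: "q - p = Suc (Suc (length u + length v))"
    using dyck_block.hyps(7) by (metis (no_types, lifting) add_Suc_right length_Cons length_append length_map length_upt)
  have bq: "Suc p \<le> b" "Suc b \<le> q"
    using len by (auto simp: b_def)
  have nth: "(x # u @ y # v) ! i = w (p + i)" if "i < q - p" for i
    using that dyck_block.hyps(7) by simp
  have "u = map w [Suc p..<b]"
  proof (rule nth_equalityI)
    fix i assume "i < length u"
    then have "(x # u @ y # v) ! Suc i = u ! i" "i < b - Suc p" by (simp_all add: nth_append b_def)
    then show "u ! i = map w [Suc p..<b] ! i" using nth[of "Suc i"] len \<open>i < length u\<close> by simp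
  qed (simp add: b_def del: upt_Suc)
  then have IHu: "l (Suc p) = l b \<and> (\<forall>r. Suc p \<le> r \<and> r \<le> b \<longrightarrow> l (Suc p) \<le> l r)"
    by (rule dyck_block.hyps(2)[OF _ bq(1)]) (use bq dyck_block.prems in linarith)
  have "v = map w [Suc b..<q]"
  proof (rule nth_equalityI)
    show "length v = length (map w [Suc b..<q])" using len by (simp add: b_def del: upt_Suc)
    fix i assume "i < length v"
    then show "v ! i = map w [Suc b..<q] ! i"
      using nth[of "Suc (Suc (length u + i))"] len by (simp add: b_def nth_append add.assoc del: upt_Suc)
  qed
  then have IHv: "l (Suc b) = l q \<and> (\<forall>r. Suc b \<le> r \<and> r \<le> q \<longrightarrow> l (Suc b) \<le> l r)"
    by (rule dyck_block.hyps(4)[OF _ bq(2) dyck_block.prems(2)])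
  have x: "x = w p" using nth[of 0] len by simp
  have y: "y = w b" using nth[of "Suc (length u)"] len by (simp add: b_def nth_append)
  have lp: "l (Suc p) = l p + 1" using up[of p] dyck_block x len by auto
  have lb: "l (Suc b) = l b - 1" using up[of b] dyck_block y len by (auto simp: b_def)
  show ?case
  proof (intro conjI allI impI)
    show "l p = l q" using IHu IHv lp lb by linarith
    fix r assume "p \<le> r \<and> r \<le> q"
    then consider "r = p" | "Suc p \<le> r" "r \<le> b" | "Suc b \<le> r" "r \<le> q" by linarith
    then show "l p \<le> l r"
      using IHu IHv lp lb by cases (simp, (metis add_leE le_trans), (metis add_diff_cancel_right'))
  qed
qed

text \<open>Converse of \<open>dyck_levels\<close>, by splitting at the first return to the initial
  level. The letter before that return descends, and strictly in between the level is higher, so one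
  unit less of height is left for the interior.\<close>

lemma dyck_of_levels:
  fixes l :: "nat \<Rightarrow> nat"
  assumes up: "\<And>i. i < n \<Longrightarrow> l (Suc i) = (if up (w i) then l i + 1 else l i - 1) \<and> (\<not> up (w i) \<longrightarrow> l i > 0)"
  shows "p \<le> q \<Longrightarrow> q \<le> n \<Longrightarrow> l p = l q \<Longrightarrow> (\<And>r. p \<le> r \<Longrightarrow> r \<le> q \<Longrightarrow> l p \<le> l r \<and> l r \<le> l p + h) \<Longrightarrow>
    dyck up h (map w [p..<q])"
proof (induction "q - p" arbitrary: p q h rule: less_induct)
  case less
  show ?case
  proof (cases "p = q")
    case True
    then show ?thesis by (simp add: dyck_Nil)
  next
    case False
    with less.prems have pq: "p < q" by simp
    then have lp: "l (Suc p) = l p + 1" and upp: "up (w p)"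
      using up[of p] less.prems(2) less.prems(4)[of "Suc p"] by (auto split: if_splits)
    have "h \<noteq> 0" using less.prems(4)[of "Suc p"] pq lp by auto
    then obtain h' where h: "h = Suc h'" using not0_implies_Suc by blast
    define r where "r = (LEAST r. p < r \<and> l r = l p)"
    have r: "p < r" "l r = l p" and rq: "r \<le> q"
      using LeastI[of "\<lambda>r. p < r \<and> l r = l p" q] Least_le[of "\<lambda>r. p < r \<and> l r = l p" q] pq less.prems(3)
      by (auto simp: r_def)
    have below: "l p < l s" if "p < s" "s < r" for s
      using not_less_Least[of s "\<lambda>r. p < r \<and> l r = l p"] that less.prems(4)[of s] rq
      by (fastforce simp: r_def)
    obtain b where b: "r = Suc b" using r(1) by (cases r) auto
    have pb: "p < b" using b r lp by (metis less_antisym n_not_Suc_n Suc_eq_plus1)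
    have lb: "l b = l p + 1" "\<not> up (w b)"
      using up[of b] below[of b] b r rq less.prems(2) pb by (auto split: if_splits)
    have "dyck up h' (map w [Suc p..<b])"
    proof (rule less.hyps)
      fix s assume "Suc p \<le> s" "s \<le> b"
      then show "l (Suc p) \<le> l s \<and> l s \<le> l (Suc p) + h'"
        using below[of s] less.prems(4)[of s] b rq lp by (auto simp: h)
    qed (use pb b rq lp lb less.prems in auto)
    moreover have "dyck up (Suc h') (map w [r..<q])"
      using less.prems(4) r rq less.prems(2,3)
      by (intro less.hyps) (auto simp: h)
    ultimately have "dyck up h (w p # map w [Suc p..<b] @ w b # map w [r..<q])"
      unfolding h using upp lb(2) by (rule dyck_block)
    moreover have "[p..<q] = p # [Suc p..<b] @ b # [r..<q]"
      using upt_conv_Cons[OF pq] upt_conv_Cons[of b q] upt_add_eq_append[of "Suc p" b "q - b"] pb b rq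
      by simp
    ultimately show ?thesis by simp
  qed
qed


section \<open>Separations and Menger's theorem\<close>

text \<open>Every value from 2 on counts as right here, and values outside the vertex set are
  arbitrary; \<open>seps\<close> normalises both. Coding separations as functions turns uncrossing
  into pointwise maximum and minimum.\<close>

definition sep :: "('a \<times> 'a) set \<Rightarrow> ('a \<Rightarrow> nat) \<Rightarrow> bool" where
  "sep E s \<longleftrightarrow> (\<forall>u v. (u, v) \<in> E \<longrightarrow> s u = 0 \<longrightarrow> s v < 2)"

definition middle :: "'a set \<Rightarrow> ('a \<Rightarrow> nat) \<Rightarrow> 'a set" where
  "middle V s = {v \<in> V. s v = 1}"

lemma finite_middle: "finite V \<Longrightarrow> finite (middle V s)"
  by (simp add: middle_def)

text \<open>A path is kept only as a vertex set \<open>U x\<close> inside which \<open>g x\<close>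
  is reachable from \<open>x\<close>, so that gluing paths is a union. Genuine paths are extracted
  later by \<open>induced_path_exists\<close>.\<close>

definition linkage ::
  "'a set \<Rightarrow> ('a \<times> 'a) set \<Rightarrow> 'a set \<Rightarrow> 'a set \<Rightarrow> ('a \<Rightarrow> 'a) \<Rightarrow> ('a \<Rightarrow> 'a set) \<Rightarrow> bool" where
  "linkage V E X Y g U \<longleftrightarrow> bij_betw g X Y \<and>
     (\<forall>x\<in>X. x \<in> U x \<and> g x \<in> U x \<and> U x \<subseteq> V \<and> (x, g x) \<in> (E \<inter> U x \<times> U x)\<^sup>*) \<and>
     (\<forall>x\<in>X. \<forall>y\<in>X. x \<noteq> y \<longrightarrow> U x \<inter> U y = {})"

text \<open>Menger's theorem, by induction on the number of edges: if \<open>s\<close> is a too small separation of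
  \<open>E - {(u, v)}\<close>, then no small separation separates \<open>X\<close> from \<open>middle V s \<union> {u}\<close> on the left side
  of \<open>s\<close>, or \<open>middle V s \<union> {v}\<close> from \<open>Y\<close> on its right side.\<close>

theorem Menger_equicardinal:
  assumes "finite V" "E \<subseteq> V \<times> V" "X \<subseteq> V" "Y \<subseteq> V" "card X = t" "card Y = t"
    and "\<And>s. sep E s \<Longrightarrow> \<forall>x\<in>X. s x \<le> 1 \<Longrightarrow> \<forall>y\<in>Y. 1 \<le> s y \<Longrightarrow> t \<le> card (middle V s)"
  shows "\<exists>g U. linkage V E X Y g U"
  using assms
proof (induction "card E" arbitrary: V E X Y rule: less_induct)
  case less
  note fV = less.prems(1) and EV = less.prems(2) and XV = less.prems(3) and YV = less.prems(4)
    and cX = less.prems(5) and cY = less.prems(6) and conn = less.prems(7)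
  have fE: "finite E" using fV EV by (meson finite_SigmaI finite_subset)
  have fX: "finite X" and fY: "finite Y" using fV XV YV finite_subset by auto
  show ?case
  proof (cases "E = {}")
    case True
    \<comment> \<open>Without edges every function is a separation. This one has middle
      \<open>X \<inter> Y\<close>, which must then have \<open>t\<close> elements and equal both
      \<open>X\<close> and \<open>Y\<close>.\<close>
    define s :: "'a \<Rightarrow> nat" where "s v = (if v \<in> X then if v \<in> Y then 1 else 0 else 2)" for v
    have "middle V s = X \<inter> Y" using XV by (auto simp: middle_def s_def)
    moreover have "t \<le> card (middle V s)" by (rule conn) (auto simp: sep_def s_def True)
    ultimately have "X \<inter> Y = X" "X \<inter> Y = Y"
      using card_seteq[OF fX, of "X \<inter> Y"] card_seteq[OF fY, of "X \<inter> Y"] cX cY by auto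
    then have "linkage V E X Y id (\<lambda>x. {x})"
      using XV unfolding linkage_def by auto
    then show ?thesis by blast
  next
    case False
    then obtain u v where e: "(u, v) \<in> E" by auto
    let ?E = "E - {(u, v)}"
    show ?thesis
    proof (cases "\<forall>s. sep ?E s \<longrightarrow> (\<forall>x\<in>X. s x \<le> 1) \<longrightarrow> (\<forall>y\<in>Y. 1 \<le> s y) \<longrightarrow> t \<le> card (middle V s)")
      case True
      have "card ?E < card E" using e fE by (meson card_Diff1_less)
      then obtain g U where "linkage V ?E X Y g U"
        using less.hyps[of ?E V X Y] EV XV YV cX cY fV True by blast
      then have "linkage V E X Y g U"
        unfolding linkage_def by (meson Diff_subset Int_mono order_refl rtrancl_mono subsetD)
      then show ?thesis by blast
    next
      case False
      then obtain s where s: "sep ?E s" "\<forall>x\<in>X. s x \<le> 1" "\<forall>y\<in>Y. 1 \<le> s y" "card (middle V s) < t"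
        by (auto simp: not_le)
      have "\<not> sep E s" using conn s by (meson not_less)
      then obtain a b where ab: "(a, b) \<in> E" "s a = 0" "2 \<le> s b" by (auto simp: sep_def not_less)
      then have "(a, b) = (u, v)" using s(1) unfolding sep_def by force
      with ab have suv: "s u = 0" "2 \<le> s v" by auto
      define S where "S = middle V s"
      define A where "A = {x \<in> V. s x \<le> 1}"
      define B where "B = {x \<in> V. 1 \<le> s x}"
      have uv: "u \<in> A" "u \<notin> B" "v \<in> B" "v \<notin> A" "u \<notin> S" "v \<notin> S" "u \<noteq> v"
        using suv e EV by (auto simp: A_def B_def S_def middle_def)
      have S: "S = A \<inter> B" by (auto simp: A_def B_def S_def middle_def)
      have fS: "finite S" "finite A" "finite B" using fV by (auto simp: S_def middle_def A_def B_def)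
      have XA: "X \<subseteq> A" and YB: "Y \<subseteq> B" using s XV YV by (auto simp: A_def B_def)
      have other: "s b < 2" if "(a, b) \<in> E" "s a = 0" "(a, b) \<noteq> (u, v)" for a b
        using s(1) that unfolding sep_def by blast
      \<comment> \<open>Moving \<open>u\<close> into the middle turns \<open>s\<close> into a
        separation of \<open>E\<close>, so \<open>S\<close> has exactly \<open>t - 1\<close>
        elements.\<close>
      have "t \<le> card (middle V (s(u := 1)))"
      proof (rule conn)
        show "sep E (s(u := 1))"
          using other uv unfolding sep_def by (metis fun_upd_other fun_upd_same one_less_numeral_iff prod.inject semiring_norm(76) zero_neq_one)
      qed (use s in auto)
      moreover have "middle V (s(u := 1)) = insert u S"
        using uv by (auto simp: middle_def S_def A_def)
      ultimately have cS: "card (insert u S) = t" "card (insert v S) = t"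
        using s(4) uv fS by (auto simp: S_def[symmetric])
      have "\<exists>g U. linkage A (E \<inter> A \<times> A) X (insert u S) g U"
      proof (rule less.hyps)
        show "card (E \<inter> A \<times> A) < card E"
          by (rule psubset_card_mono[OF fE]) (use e uv in auto)
        fix r
        assume r: "sep (E \<inter> A \<times> A) r" "\<forall>x\<in>X. r x \<le> 1" "\<forall>y\<in>insert u S. 1 \<le> r y"
        \<comment> \<open>A separation of the left part extends by the value 2: a vertex of
          \<open>A\<close> with \<open>r\<close>-value 0 avoids \<open>S\<close> and
          \<open>u\<close>, hence has \<open>s\<close>-value 0, and its edges stay inside
          \<open>A\<close>.\<close>
        let ?r = "\<lambda>x. if x \<in> A then r x else 2"
        have "sep E ?r"
          unfolding sep_def
        proof (intro allI impI)
          fix a b assume ab: "(a, b) \<in> E" "?r a = 0"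
          then have a: "a \<in> A" "r a = 0" by (auto split: if_splits)
          then have "a \<notin> insert u S" using r(3) by force
          then have "s a = 0" "a \<noteq> u" using a by (auto simp: S A_def B_def)
          then have "b \<in> A" using other[of a b] ab EV by (auto simp: A_def)
          then show "?r b < 2" using r(1) a ab by (auto simp: sep_def)
        qed
        then have "t \<le> card (middle V ?r)"
          by (rule conn) (use r XA YB S in force)+
        also have "middle V ?r = middle A r" by (auto simp: middle_def A_def)
        finally show "t \<le> card (middle A r)" .
      qed (use fS XA uv S cX cS in auto)
      then obtain g1 U1 where L1: "linkage A (E \<inter> A \<times> A) X (insert u S) g1 U1" by blast
      have "\<exists>g U. linkage B (E \<inter> B \<times> B) (insert v S) Y g U"
      proof (rule less.hyps)
        show "card (E \<inter> B \<times> B) < card E"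
          by (rule psubset_card_mono[OF fE]) (use e uv in auto)
        fix r
        assume r: "sep (E \<inter> B \<times> B) r" "\<forall>x\<in>insert v S. r x \<le> 1" "\<forall>y\<in>Y. 1 \<le> r y"
        let ?r = "\<lambda>x. if x \<in> B then r x else 0"
        have "sep E ?r"
          unfolding sep_def
        proof (intro allI impI, rule ccontr)
          fix a b assume ab: "(a, b) \<in> E" "?r a = 0" "\<not> ?r b < 2"
          then have b: "b \<in> B" "2 \<le> r b" by (auto split: if_splits)
          then have "b \<notin> insert v S" using r(2) by force
          then have "2 \<le> s b" "b \<noteq> v" using b by (auto simp: S A_def B_def)
          then have "s a \<noteq> 0" using other[of a b] ab(1) by force
          then have "a \<in> B" using ab(1) EV by (auto simp: B_def)
          then show False using r(1) b ab by (auto simp: sep_def)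
        qed
        then have "t \<le> card (middle V ?r)"
          by (rule conn) (use r XA YB S in force)+
        also have "middle V ?r = middle B r" by (auto simp: middle_def B_def)
        finally show "t \<le> card (middle B r)" .
      qed (use fS YB uv S cY cS in auto)
      then obtain g2 U2 where L2: "linkage B (E \<inter> B \<times> B) (insert v S) Y g2 U2" by blast
      \<comment> \<open>The deleted edge joins the path ending at \<open>u\<close> to the one
        starting at \<open>v\<close>; all other paths are joined at a common vertex of
        \<open>S\<close>.\<close>
      define h where "h z = (if z = u then v else z)" for z
      define U where "U x = U1 x \<union> U2 (h (g1 x))" for x
      have bij1: "bij_betw g1 X (insert u S)" and bij2: "bij_betw g2 (insert v S) Y"
        using L1 L2 by (auto simp: linkage_def)
      have bijh: "bij_betw h (insert u S) (insert v S)"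
        using uv by (auto simp: bij_betw_def inj_on_def h_def)
      have g1: "g1 x \<in> insert u S" "h (g1 x) \<in> insert v S" if "x \<in> X" for x
        using bij_betw_apply[OF bij1 that] bij_betw_apply[OF bijh] by auto
      have hg_inj: "x = y" if "h (g1 x) = h (g1 y)" "x \<in> X" "y \<in> X" for x y
        using that g1 bij_betw_imp_inj_on[OF bij1] bij_betw_imp_inj_on[OF bijh]
        by (metis inj_on_eq_iff)
      have U1: "x \<in> U1 x" "g1 x \<in> U1 x" "U1 x \<subseteq> A" "(x, g1 x) \<in> (E \<inter> A \<times> A \<inter> U1 x \<times> U1 x)\<^sup>*"
        if "x \<in> X" for x using L1 that by (auto simp: linkage_def)
      have U1_eq: "x = y" if "z \<in> U1 x" "z \<in> U1 y" "x \<in> X" "y \<in> X" for x y z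
        using L1 that unfolding linkage_def by (meson disjoint_iff)
      have U2: "x \<in> U2 x" "g2 x \<in> U2 x" "U2 x \<subseteq> B" "(x, g2 x) \<in> (E \<inter> B \<times> B \<inter> U2 x \<times> U2 x)\<^sup>*"
        if "x \<in> insert v S" for x using L2 that unfolding linkage_def by blast+
      have U2_eq: "x = y" if "z \<in> U2 x" "z \<in> U2 y" "x \<in> insert v S" "y \<in> insert v S" for x y z
        using L2 that unfolding linkage_def by (meson disjoint_iff)
      \<comment> \<open>Sets from opposite sides can meet only in \<open>S\<close>, each vertex of
        which is the end of one left path and the start of one right path.\<close>
      have cross: "x = y" if z: "z \<in> U1 x" "z \<in> U2 (h (g1 y))" and xy: "x \<in> X" "y \<in> X" for x y z
      proof -
        have zS: "z \<in> S" using U1(3)[OF xy(1)] U2(3)[OF g1(2)[OF xy(2)]] z S by blast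
        then obtain x0 where "x0 \<in> X" "z = g1 x0"
          using bij_betw_imp_surj_on[OF bij1] by blast
        then have "z = g1 x" using U1_eq U1(2) z xy by blast
        then have hz: "h (g1 x) = z" using zS uv by (auto simp: h_def)
        have "h (g1 y) = z" using U2_eq[of z "h (g1 y)" z] U2(1) zS z g1 xy by blast
        with hz show ?thesis using hg_inj xy by metis
      qed
      have "linkage V E X Y (g2 \<circ> h \<circ> g1) U"
        unfolding linkage_def
      proof (intro conjI ballI impI)
        show "bij_betw (g2 \<circ> h \<circ> g1) X Y"
          using bij1 bij2 bijh by (auto intro: bij_betw_trans)
        fix x assume x: "x \<in> X"
        show "x \<in> U x" using U1 x by (auto simp: U_def)
        show "(g2 \<circ> h \<circ> g1) x \<in> U x" using U2 g1 x by (auto simp: U_def)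
        show "U x \<subseteq> V" using U1(3) U2(3) g1 x by (fastforce simp: U_def A_def B_def)
        have "(x, g1 x) \<in> (E \<inter> U x \<times> U x)\<^sup>*"
          by (rule subsetD[OF rtrancl_mono U1(4)[OF x]]) (auto simp: U_def)
        also have "(g1 x, h (g1 x)) \<in> (E \<inter> U x \<times> U x)\<^sup>*"
          using e U1(2)[OF x] U2(1)[OF g1(2)[OF x]] by (auto simp: h_def U_def)
        also have "(h (g1 x), g2 (h (g1 x))) \<in> (E \<inter> U x \<times> U x)\<^sup>*"
          by (rule subsetD[OF rtrancl_mono U2(4)[OF g1(2)[OF x]]]) (auto simp: U_def)
        finally show "(x, (g2 \<circ> h \<circ> g1) x) \<in> (E \<inter> U x \<times> U x)\<^sup>*" by simp
        fix y assume y: "y \<in> X" "x \<noteq> y"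
        show "U x \<inter> U y = {}"
          using U1_eq[of _ x y] U2_eq[of _ "h (g1 x)" "h (g1 y)"] cross[of _ x y] cross[of _ y x]
            hg_inj[of x y] g1(2) x y unfolding U_def by blast
      qed
      then show ?thesis by blast
    qed
  qed
qed


section \<open>Linked chains of separations\<close>

text \<open>Fixing the value 0 outside \<open>V\<close> makes this set finite and lets separations
  be compared by the pointwise order of functions.\<close>

definition seps :: "'a set \<Rightarrow> ('a \<times> 'a) set \<Rightarrow> ('a \<Rightarrow> nat) set" where
  "seps V E = {s. sep E s \<and> (\<forall>v. s v \<le> (if v \<in> V then 2 else 0))}"

definition step :: "'a set \<Rightarrow> ('a \<Rightarrow> nat) \<Rightarrow> ('a \<Rightarrow> nat) \<Rightarrow> bool" where
  "step V s r \<longleftrightarrow> (\<exists>v\<in>V. 0 < s v \<and> r = s(v := s v - 1))"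

definition sep_chain :: "'a set \<Rightarrow> ('a \<times> 'a) set \<Rightarrow> nat \<Rightarrow> ('a \<Rightarrow> nat) list \<Rightarrow> bool" where
  "sep_chain V E K xs \<longleftrightarrow> xs \<noteq> [] \<and> hd xs = (\<lambda>v. if v \<in> V then 2 else 0) \<and> last xs = (\<lambda>v. 0) \<and>
     successively (\<lambda>s r. s = r \<or> step V s r) xs \<and>
     (\<forall>s\<in>set xs. s \<in> seps V E \<and> card (middle V s) \<le> K)"

text \<open>Only separations pointwise between the two members are tested;
  \<open>path_system_exists\<close> reduces the arbitrary separations of Menger's theorem to these
  by clamping.\<close>

definition linked :: "'a set \<Rightarrow> ('a \<times> 'a) set \<Rightarrow> ('a \<Rightarrow> nat) list \<Rightarrow> bool" where
  "linked V E xs \<longleftrightarrow> (\<forall>i j t s. i \<le> j \<and> j < length xs \<and> s \<in> seps V E \<and> xs ! j \<le> s \<and> s \<le> xs ! i \<and>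
     (\<forall>m. i \<le> m \<and> m \<le> j \<longrightarrow> t \<le> card (middle V (xs ! m))) \<longrightarrow> t \<le> card (middle V s))"

lemma finite_seps:
  assumes "finite V" shows "finite (seps V E)"
proof (rule finite_subset)
  show "seps V E \<subseteq> {f. \<forall>x. (x \<in> V \<longrightarrow> f x \<in> {..2}) \<and> (x \<notin> V \<longrightarrow> f x = 0)}"
    by (auto simp: seps_def)
  show "finite {f :: 'a \<Rightarrow> nat. \<forall>x. (x \<in> V \<longrightarrow> f x \<in> {..2}) \<and> (x \<notin> V \<longrightarrow> f x = 0)}"
    by (rule finite_set_of_finite_funs) (use assms in auto)
qed

lemma seps_sup: "s \<in> seps V E \<Longrightarrow> r \<in> seps V E \<Longrightarrow> sup s r \<in> seps V E"
  unfolding seps_def sep_def by (simp add: sup_nat_def)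

lemma seps_inf:
  assumes "s \<in> seps V E" "r \<in> seps V E"
  shows "inf s r \<in> seps V E"
  unfolding seps_def mem_Collect_eq
proof (intro conjI allI)
  show "sep E (inf s r)"
    unfolding sep_def
  proof (intro allI impI)
    fix u v assume uv: "(u, v) \<in> E" "inf s r u = 0"
    then have "s u = 0 \<or> r u = 0" by (auto simp: inf_nat_def min_def split: if_splits)
    then have "s v < 2 \<or> r v < 2" using assms uv(1) by (auto simp: seps_def sep_def)
    then show "inf s r v < 2" by (auto simp: inf_nat_def)
  qed
  show "inf s r v \<le> (if v \<in> V then 2 else 0)" for v
    using assms(1) by (simp add: seps_def inf_nat_def min.coboundedI1)
qed

text \<open>At each vertex the maximum and the minimum are the two given values in some order, so
  the number of ones is preserved exactly and not merely submodular.\<close>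

lemma middle_modular:
  assumes "finite V"
  shows "card (middle V (sup s r)) + card (middle V (inf s r)) = card (middle V s) + card (middle V r)"
proof -
  have c: "card (middle V f) = (\<Sum>v\<in>V. if f v = 1 then 1 else 0)" for f
    by (simp only: middle_def card_eq_sum sum.inter_filter[OF assms])
  show ?thesis
    unfolding c sum.distrib[symmetric]
    by (rule sum.cong) (auto simp: sup_nat_def inf_nat_def max_def min_def)
qed

lemma step_le: "step V s r \<Longrightarrow> r \<le> s"
  by (auto simp: step_def le_fun_def)

lemma step_sup: "step V a b \<Longrightarrow> sup s a = sup s b \<or> step V (sup s a) (sup s b)"
proof -
  assume "step V a b"
  then obtain v where v: "v \<in> V" "0 < a v" "b = a(v := a v - 1)" by (auto simp: step_def)
  show ?thesis
  proof (cases "a v \<le> s v")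
    case True
    then have "sup s a = sup s b" by (auto simp: v(3) fun_eq_iff sup_nat_def)
    then show ?thesis ..
  next
    case False
    then have "sup s b = (sup s a)(v := sup s a v - 1)" by (auto simp: v(3) fun_eq_iff sup_nat_def)
    moreover have "0 < sup s a v" using v False by (simp add: sup_nat_def)
    ultimately show ?thesis unfolding step_def using v(1) by blast
  qed
qed

lemma step_inf: "step V a b \<Longrightarrow> inf s a = inf s b \<or> step V (inf s a) (inf s b)"
proof -
  assume "step V a b"
  then obtain v where v: "v \<in> V" "0 < a v" "b = a(v := a v - 1)" by (auto simp: step_def)
  show ?thesis
  proof (cases "s v < a v")
    case True
    then have "inf s a = inf s b" by (auto simp: v(3) fun_eq_iff inf_nat_def)
    then show ?thesis ..
  next
    case False
    then have "inf s b = (inf s a)(v := inf s a v - 1)" by (auto simp: v(3) fun_eq_iff inf_nat_def)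
    moreover have "0 < inf s a v" using v False by (simp add: inf_nat_def)
    ultimately show ?thesis unfolding step_def using v(1) by blast
  qed
qed

lemma sep_chain_antimono:
  assumes "sep_chain V E K xs" "i \<le> j" "j < length xs"
  shows "xs ! j \<le> xs ! i"
  using assms(2,3)
proof (induction j rule: dec_induct)
  case (step j)
  have "xs ! Suc j \<le> xs ! j"
    using assms(1) step by (auto simp: sep_chain_def successively_conv_nth dest!: step_le)
  with step show ?case by auto
qed simp

lemma sep_chain_remdups_adj:
  assumes "sep_chain V E K xs"
  shows "sep_chain V E K (remdups_adj xs)" "successively (step V) (remdups_adj xs)"
proof -
  show *: "sep_chain V E K (remdups_adj xs)"
    using assms by (auto simp: sep_chain_def intro: successively_remdups_adjI)
  have "distinct_adj (remdups_adj xs)" by simp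
  with * show "successively (step V) (remdups_adj xs)"
    unfolding sep_chain_def distinct_adj_def successively_conv_nth by blast
qed

text \<open>The maxima with \<open>s\<close> descend from the top to \<open>s\<close>, and the
  minima descend from \<open>s\<close> to zero. The concatenation is therefore a chain through
  \<open>s\<close>.\<close>

lemma sep_chain_cross:
  assumes xs: "sep_chain V E K xs" and s: "s \<in> seps V E"
    and ord: "\<And>r. r \<in> set xs \<Longrightarrow> card (middle V (sup s r)) \<le> K \<and> card (middle V (inf s r)) \<le> K"
  shows "sep_chain V E K (map (sup s) xs @ map (inf s) xs)"
proof -
  let ?top = "\<lambda>v. if v \<in> V then 2 else 0 :: nat"
  have le: "s \<le> ?top" using s by (auto simp: seps_def le_fun_def)
  have ends: "sup s ?top = ?top" "inf s ?top = s" "sup s (\<lambda>v. 0) = s" "inf s (\<lambda>v. 0) = (\<lambda>v. 0)"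
    using le by (auto simp: sup_absorb2 inf_absorb1) (auto simp: fun_eq_iff sup_nat_def inf_nat_def)
  have succ: "successively (\<lambda>s r. s = r \<or> step V s r) (map (sup s) xs)"
    "successively (\<lambda>s r. s = r \<or> step V s r) (map (inf s) xs)"
    using xs step_sup step_inf unfolding sep_chain_def successively_map
    by (auto elim!: successively_mono) blast+
  show ?thesis
    unfolding sep_chain_def
  proof (intro conjI ballI)
    show "successively (\<lambda>s r. s = r \<or> step V s r) (map (sup s) xs @ map (inf s) xs)"
      using succ xs ends by (auto simp: successively_append_iff sep_chain_def last_map hd_map)
    fix r assume "r \<in> set (map (sup s) xs @ map (inf s) xs)"
    then show "r \<in> seps V E" "card (middle V r) \<le> K"
      using xs ord s by (auto simp: sep_chain_def intro!: seps_sup seps_inf)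
  qed (use xs ends in \<open>auto simp: sep_chain_def hd_append last_map hd_map\<close>)
qed

text \<open>A chain that lexicographically maximises the numbers of members of order \<open>0, 1, 2, \<dots>\<close>
  is linked: a separation \<open>s\<close> violating linkedness could be inserted by uncrossing.\<close>

theorem linked_sep_chain:
  assumes fin: "finite V" and ex: "sep_chain V E K xs0"
  obtains xs where "sep_chain V E K xs" "successively (step V) xs" "linked V E xs"
proof -
  let ?o = "\<lambda>s. card (middle V s)"
  define N where "N = Suc (card (seps V E))"
  \<comment> \<open>As \<open>N\<close> exceeds the number of all separations, one member of a given
    order outweighs all members of higher order together. Comparing \<open>W\<close> thus amounts to
    the lexicographic comparison.\<close>
  define W where "W xs = (\<Sum>s\<in>set xs. N ^ (K - ?o s))" for xs
  have sub: "set xs \<subseteq> seps V E" if "sep_chain V E K xs" for xs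
    using that by (auto simp: sep_chain_def)
  have "\<forall>xs. sep_chain V E K xs \<longrightarrow> W xs < Suc (\<Sum>s\<in>seps V E. N ^ (K - ?o s))"
    unfolding W_def less_Suc_eq_le using sub finite_seps[OF fin] by (auto intro!: sum_mono2)
  then obtain xs1 where xs1: "sep_chain V E K xs1" "\<And>ys. sep_chain V E K ys \<Longrightarrow> W ys \<le> W xs1"
    using ex_has_greatest_nat[of "sep_chain V E K" xs0 W] ex by blast
  define xs where "xs = remdups_adj xs1"
  have xs: "sep_chain V E K xs" "successively (step V) xs" "\<And>ys. sep_chain V E K ys \<Longrightarrow> W ys \<le> W xs"
    using sep_chain_remdups_adj[OF xs1(1)] xs1(2) by (auto simp: xs_def W_def)
  have "linked V E xs"
  proof (rule ccontr)
    assume "\<not> linked V E xs"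
    then obtain i j t s0 where ij: "i \<le> j" "j < length xs" and s0: "s0 \<in> seps V E" "xs ! j \<le> s0" "s0 \<le> xs ! i"
      and "\<forall>m. i \<le> m \<and> m \<le> j \<longrightarrow> t \<le> ?o (xs ! m)" and small: "?o s0 < t"
      unfolding linked_def by (auto simp: not_le)
    then have t: "t \<le> ?o (xs ! m)" if "i \<le> m" "m \<le> j" for m using that by blast
    define P where "P s \<longleftrightarrow> s \<in> seps V E \<and> xs ! j \<le> s \<and> s \<le> xs ! i" for s
    \<comment> \<open>The least order is chosen so that crossing \<open>s\<close> with a member
      between \<open>i\<close> and \<open>j\<close> gives two candidates of order at least that of
      \<open>s\<close>. By modularity neither then exceeds the order of that member.\<close>
    obtain s where s: "P s" and smin: "\<And>r. P r \<Longrightarrow> ?o s \<le> ?o r"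
      using ex_has_least_nat[of P s0 ?o] s0 by (auto simp: P_def)
    have os: "?o s < t" using smin[of s0] s0 small by (auto simp: P_def)
    have mem: "xs ! m \<in> seps V E" "?o (xs ! m) \<le> K" if "m < length xs" for m
      using xs(1) that by (auto simp: sep_chain_def)
    have tK: "t \<le> K" using t[of i] mem[of i] ij by linarith
    have outside: "sup s (xs ! m) = xs ! m \<and> inf s (xs ! m) = s \<or> sup s (xs ! m) = s \<and> inf s (xs ! m) = xs ! m"
      if "m < length xs" "\<not> (i \<le> m \<and> m \<le> j)" for m
    proof (cases "m < i")
      case True
      then have "s \<le> xs ! m"
        using s sep_chain_antimono[OF xs(1), of m i] ij unfolding P_def by (auto intro: order_trans)
      then show ?thesis by (simp add: sup_absorb2 inf_absorb1)
    next
      case False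
      then have "xs ! m \<le> s"
        using s sep_chain_antimono[OF xs(1), of j m] ij that unfolding P_def by (auto intro: order_trans)
      then show ?thesis by (simp add: sup_absorb1 inf_absorb2)
    qed
    let ?ys = "map (sup s) xs @ map (inf s) xs"
    have ys: "sep_chain V E K ?ys"
    proof (rule sep_chain_cross[OF xs(1)])
      show "s \<in> seps V E" using s by (simp add: P_def)
      fix r assume "r \<in> set xs"
      then obtain m where m: "m < length xs" "r = xs ! m" by (auto simp: in_set_conv_nth)
      show "?o (sup s r) \<le> K \<and> ?o (inf s r) \<le> K"
      proof (cases "i \<le> m \<and> m \<le> j")
        case True
        have "xs ! j \<le> xs ! m" "xs ! m \<le> xs ! i"
          using sep_chain_antimono[OF xs(1)] True m ij by auto
        then have Psr: "P (sup s r)" "P (inf s r)"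
          using s mem[OF m(1)] m(2) seps_sup seps_inf by (auto simp: P_def le_supI1 le_infI1)
        then show ?thesis
          using smin[OF Psr(1)] smin[OF Psr(2)] middle_modular[OF fin, of s r] mem(2)[OF m(1)]
          unfolding m(2) by linarith
      next
        case False
        then show ?thesis using outside[OF m(1)] mem[OF m(1)] m(2) os tK by auto
      qed
    qed
    \<comment> \<open>Members of order below \<open>t\<close> lie outside the range from
      \<open>i\<close> to \<open>j\<close>, are comparable with \<open>s\<close>, and so survive the
      crossing. Only members of order at least \<open>t\<close> can be lost, while \<open>s\<close>
      is gained.\<close>
    let ?L = "{r \<in> set xs. ?o r < t}"
    have sxs: "s \<notin> set xs"
    proof
      assume "s \<in> set xs"
      then obtain m where m: "m < length xs" "s = xs ! m" by (auto simp: in_set_conv_nth)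
      then have *: "\<not> (i \<le> m \<and> m \<le> j)" using t os by force
      have "s = xs ! i \<or> s = xs ! j"
      proof (cases "m < i")
        case True
        then show ?thesis using sep_chain_antimono[OF xs(1), of m i] m s ij by (auto simp: P_def)
      next
        case False
        then show ?thesis using sep_chain_antimono[OF xs(1), of j m] m s ij * by (auto simp: P_def)
      qed
      then show False using t[of i] t[of j] ij os by auto
    qed
    have "insert s ?L \<subseteq> set ?ys"
    proof -
      have "xs \<noteq> []" "last xs = (\<lambda>v. 0)" using xs(1) by (auto simp: sep_chain_def)
      then have "sup s (\<lambda>v. 0) \<in> set ?ys" by (metis UnI1 image_eqI last_in_set list.set_map set_append)
      then have "s \<in> set ?ys" by (simp add: sup_absorb1 le_fun_def)
      moreover have "r \<in> set ?ys" if r: "r \<in> ?L" for r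
      proof -
        obtain m where m: "m < length xs" "r = xs ! m" using r by (auto simp: in_set_conv_nth)
        then have "\<not> (i \<le> m \<and> m \<le> j)" using t r by force
        then have "sup s r = r \<or> inf s r = r" using outside m by auto
        then show ?thesis using r by (metis (no_types, lifting) UnCI image_eqI list.set_map mem_Collect_eq set_append)
      qed
      ultimately show ?thesis by blast
    qed
    then have "(\<Sum>r\<in>insert s ?L. N ^ (K - ?o r)) \<le> W ?ys"
      unfolding W_def by (intro sum_mono2) auto
    then have "N ^ (K - ?o s) + (\<Sum>r\<in>?L. N ^ (K - ?o r)) \<le> W xs"
      using sxs xs(3)[OF ys] by simp
    also have "W xs = (\<Sum>r\<in>?L. N ^ (K - ?o r)) + (\<Sum>r\<in>set xs - ?L. N ^ (K - ?o r))"
      unfolding W_def by (subst sum.subset_diff[of ?L]) auto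
    also have "(\<Sum>r\<in>set xs - ?L. N ^ (K - ?o r)) \<le> card (set xs - ?L) * N ^ (K - t)"
      by (rule sum_bounded_above[where 'a = nat, simplified]) (auto simp: N_def intro!: power_increasing)
    also have "card (set xs - ?L) \<le> card (seps V E)"
      by (rule card_mono) (use sub[OF xs(1)] finite_seps[OF fin] in auto)
    finally have "N ^ (K - ?o s) \<le> card (seps V E) * N ^ (K - t)" by simp
    also have "\<dots> < N * N ^ (K - t)" by (simp add: N_def)
    also have "\<dots> = N ^ Suc (K - t)" by simp
    also have "\<dots> \<le> N ^ (K - ?o s)"
      by (rule power_increasing) (use os tK in \<open>auto simp: N_def\<close>)
    finally show False by simp
  qed
  with xs show ?thesis using that by blast
qed

section \<open>Chains of separations from path-decompositions\<close>

lemma rtrancl_successively: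
  assumes "(s, r) \<in> {(s, r). s \<in> A \<and> r \<in> A \<and> Q s r}\<^sup>*" "s \<in> A"
  shows "\<exists>xs. xs \<noteq> [] \<and> hd xs = s \<and> last xs = r \<and> successively Q xs \<and> set xs \<subseteq> A"
  using assms
proof (induction rule: rtrancl_induct)
  case base
  then show ?case by (intro exI[of _ "[s]"]) auto
next
  case (step y z)
  then obtain xs where "xs \<noteq> []" "hd xs = s" "last xs = y" "successively Q xs" "set xs \<subseteq> A" by auto
  then show ?case using step.hyps by (intro exI[of _ "xs @ [z]"]) (auto simp: successively_append_iff)
qed

text \<open>Every function pointwise between \<open>r\<close> and \<open>s\<close> is again a
  separation of small order: a vertex it puts on the left is left for \<open>r\<close>, one it puts
  on the right is right for \<open>s\<close>, and the set of bounded size contains its middle. So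
  values may be lowered one at a time in any order.\<close>

lemma sep_refine:
  assumes fin: "finite V" and EV: "E \<subseteq> V \<times> V"
  shows "r \<le> s \<Longrightarrow> (\<And>v. s v \<le> (if v \<in> V then 2 else 0)) \<Longrightarrow>
    (\<And>u v. (u, v) \<in> E \<Longrightarrow> r u = 0 \<Longrightarrow> s v < 2) \<Longrightarrow> card {v \<in> V. 1 \<le> s v \<and> r v \<le> 1} \<le> K \<Longrightarrow>
    (s, r) \<in> {(s, r). s \<in> {s \<in> seps V E. card (middle V s) \<le> K} \<and>
      r \<in> {s \<in> seps V E. card (middle V s) \<le> K} \<and> step V s r}\<^sup>*"
proof (induction "\<Sum>v\<in>V. s v" arbitrary: s rule: less_induct)
  case less
  let ?G = "{s \<in> seps V E. card (middle V s) \<le> K}"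
  have good: "q \<in> ?G" if "r \<le> q" "q \<le> s" for q
  proof -
    have rq: "r v \<le> q v" and qs: "q v \<le> s v" for v using that by (auto simp: le_fun_def)
    have "q v < 2" if "(u, v) \<in> E" "q u = 0" for u v
      using less.prems(3)[of u v] rq[of u] qs[of v] that by auto
    then have "sep E q" by (auto simp: sep_def)
    moreover have "card (middle V q) \<le> card {v \<in> V. 1 \<le> s v \<and> r v \<le> 1}"
      by (rule card_mono) (use fin qs rq in \<open>auto simp: middle_def, metis, metis\<close>)
    moreover have "q v \<le> (if v \<in> V then 2 else 0)" for v
      using qs[of v] less.prems(2)[of v] by (rule order_trans)
    ultimately show ?thesis using less.prems(4) unfolding seps_def by simp
  qed
  show ?case
  proof (cases "s = r")
    case False
    then obtain v where "s v \<noteq> r v" by (auto simp: fun_eq_iff)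
    then have v: "r v < s v" using less.prems(1) by (simp add: le_fun_def order_less_le)
    then have vV: "v \<in> V" using less.prems(2)[of v] by (auto split: if_splits)
    let ?s = "s(v := s v - 1)"
    have rs: "r \<le> ?s" "?s \<le> s" using v less.prems(1) by (auto simp: le_fun_def)
    have s1: "step V s ?s" unfolding step_def using v vV by (intro bexI[of _ v]) auto
    have "(?s, r) \<in> {(s, r). s \<in> ?G \<and> r \<in> ?G \<and> step V s r}\<^sup>*"
    proof (rule less.hyps)
      show "sum ?s V < sum s V"
        by (rule sum_strict_mono_ex1) (use fin v vV in auto)
      show "?s u \<le> (if u \<in> V then 2 else 0)" for u
        using rs(2) less.prems(2)[of u] by (auto simp: le_fun_def)
      show "?s w < 2" if "(u, w) \<in> E" "r u = 0" for u w
        using less.prems(3)[OF that] by auto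
      have "card {x \<in> V. 1 \<le> ?s x \<and> r x \<le> 1} \<le> card {x \<in> V. 1 \<le> s x \<and> r x \<le> 1}"
        by (rule card_mono) (use fin in \<open>auto split: if_splits\<close>)
      then show "card {x \<in> V. 1 \<le> ?s x \<and> r x \<le> 1} \<le> K" using less.prems(4) by simp
    qed (rule rs)
    moreover have "s \<in> ?G" "?s \<in> ?G" using good rs less.prems(1) by auto
    ultimately show ?thesis using s1 by (intro converse_rtrancl_into_rtrancl[of s ?s]) auto
  qed simp
qed

lemma path_decomposition_sep_chain:
  assumes wf: "wf_digraph G" and fin: "finite (verts G)" and pw: "path_width_at_most G k"
  shows "\<exists>xs. sep_chain (verts G) (arcs_ends G) (Suc k) xs"
proof -
  let ?V = "verts G" and ?E = "arcs_ends G"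
  obtain Ws where Ws: "path_decomposition G Ws" and width: "decomposition_width Ws \<le> int k"
    using pw by (auto simp: path_width_at_most_def)
  define n where "n = length Ws"
  define I where "I v = {i. i < n \<and> v \<in> Ws ! i}" for v
  define f where "f v = Min (I v)" for v
  define l where "l v = Max (I v)" for v
  have finI: "finite (I v)" for v by (auto simp: I_def)
  have ne: "I v \<noteq> {}" if "v \<in> ?V" for v
  proof -
    have "v \<in> \<Union> (set Ws)" using Ws that by (simp add: path_decomposition_def)
    then show ?thesis by (auto simp: I_def n_def in_set_conv_nth)
  qed
  have fl: "f v \<in> I v" "l v \<in> I v" if "v \<in> ?V" for v
    using ne[OF that] finI by (auto simp: f_def l_def)
  have bound: "f v \<le> i" "i \<le> l v" if "i \<in> I v" for v i
    using that finI by (auto simp: f_def l_def)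
  have mid: "i \<in> I v" if "v \<in> ?V" "f v \<le> i" "i \<le> l v" for v i
  proof (cases "i = f v \<or> i = l v")
    case False
    then have "Ws ! f v \<inter> Ws ! l v \<subseteq> Ws ! i"
      using Ws that fl[OF that(1)] unfolding path_decomposition_def by (simp add: I_def n_def)
    then show ?thesis using fl[OF that(1)] that(3) by (auto simp: I_def)
  qed (use fl that in auto)
  have edge: "f v \<le> l u" if uv: "(u, v) \<in> ?E" for u v
  proof -
    obtain e where "e \<in> arcs G" "u = tail G e" "v = head G e"
      using uv by (auto simp: arcs_ends_def arc_to_ends_def)
    then obtain i j where "i \<le> j" "j \<in> I u" "i \<in> I v"
      using Ws by (force simp: path_decomposition_def I_def n_def)
    then show ?thesis using bound(1)[of i v] bound(2)[of j u] by linarith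
  qed
  have EV: "?E \<subseteq> ?V \<times> ?V"
    using wf by (auto simp: arcs_ends_def arc_to_ends_def wf_digraph_def)
  have bag: "card {v \<in> ?V. f v \<le> i \<and> i \<le> l v} \<le> Suc k" for i
  proof (cases "i < n")
    case True
    have "{v \<in> ?V. f v \<le> i \<and> i \<le> l v} \<subseteq> Ws ! i" using mid by (auto simp: I_def)
    moreover have "Ws ! i \<subseteq> ?V" using Ws True by (auto simp: path_decomposition_def n_def)
    ultimately have "card {v \<in> ?V. f v \<le> i \<and> i \<le> l v} \<le> card (Ws ! i)"
      using fin by (meson card_mono finite_subset)
    also have "\<dots> \<le> Max (card ` set Ws)" using True by (auto simp: n_def)
    also have "\<dots> \<le> Suc k" using width by (simp add: decomposition_width_def)
    finally show ?thesis .
  next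
    case False
    have "l v < n" if "v \<in> ?V" for v using fl(2)[OF that] by (auto simp: I_def)
    then have "{v \<in> ?V. f v \<le> i \<and> i \<le> l v} = {}" using False by fastforce
    then show ?thesis by (simp only: card.empty)
  qed
  \<comment> \<open>Time runs at two ticks per bag, and \<open>f v\<close> and \<open>l v\<close>
    are the first and last bag of \<open>v\<close>. The middle at time \<open>2 * i + 1\<close>
    consists of the vertices with \<open>f v \<le> i\<close> and \<open>i \<le> l v\<close>, at time
    \<open>2 * i\<close> of those with \<open>f v < i\<close> and \<open>i \<le> l v\<close>. Hence
    all intermediate middles between \<open>c\<close> and \<open>Suc c\<close> fit into bag
    \<open>c div 2\<close>.\<close>
  define T :: "nat \<Rightarrow> 'a \<Rightarrow> nat" where
    "T c v = (if v \<in> ?V then if c \<le> 2 * f v then 2 else if c \<le> 2 * l v + 1 then 1 else 0 else 0)" for c v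
  let ?G = "{s \<in> seps ?V ?E. card (middle ?V s) \<le> Suc k}"
  let ?R = "{(s, r). s \<in> ?G \<and> r \<in> ?G \<and> step ?V s r}"
  have T_step: "(T c, T (Suc c)) \<in> ?R\<^sup>*" for c
  proof (rule sep_refine[OF fin EV])
    have flv: "f v \<le> l v" if "v \<in> ?V" for v using bound(1)[OF fl(2)[OF that]] .
    then show "T (Suc c) \<le> T c" by (fastforce simp: T_def le_fun_def)
    show "T c v \<le> (if v \<in> ?V then 2 else 0)" for v by (auto simp: T_def)
    show "T c v < 2" if "(u, v) \<in> ?E" "T (Suc c) u = 0" for u v
    proof -
      have "u \<in> ?V" using that EV by auto
      then have "2 * l u + 1 < Suc c" using that(2) by (auto simp: T_def split: if_splits)
      then show ?thesis using edge[OF that(1)] by (auto simp: T_def)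
    qed
    have "{v \<in> ?V. 1 \<le> T c v \<and> T (Suc c) v \<le> 1} \<subseteq> {v \<in> ?V. f v \<le> c div 2 \<and> c div 2 \<le> l v}"
      using flv by (fastforce simp: T_def split: if_splits)
    then have "card {v \<in> ?V. 1 \<le> T c v \<and> T (Suc c) v \<le> 1} \<le> card {v \<in> ?V. f v \<le> c div 2 \<and> c div 2 \<le> l v}"
      using fin by (intro card_mono) auto
    then show "card {v \<in> ?V. 1 \<le> T c v \<and> T (Suc c) v \<le> 1} \<le> Suc k" using bag le_trans by blast
  qed
  then have "(T 0, T c) \<in> ?R\<^sup>*" for c
    by (induction c) (auto intro: rtrancl_trans)
  then have T: "(T 0, T (2 * n)) \<in> ?R\<^sup>*" .
  have T0: "T 0 = (\<lambda>v. if v \<in> ?V then 2 else 0)" by (auto simp: T_def)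
  have Tn: "T (2 * n) = (\<lambda>v. 0)"
  proof
    fix v
    have "f v < n \<and> l v < n" if "v \<in> ?V" using fl[OF that] by (auto simp: I_def)
    then show "T (2 * n) v = 0" by (auto simp: T_def)
  qed
  have T0G: "T 0 \<in> ?G"
  proof -
    have "sep ?E (T 0)" using EV by (auto simp: T0 sep_def)
    moreover have "middle ?V (T 0) = {}" by (auto simp: T0 middle_def)
    ultimately show ?thesis by (auto simp: seps_def T_def)
  qed
  obtain xs where "xs \<noteq> []" "hd xs = T 0" "last xs = T (2 * n)"
    "successively (step ?V) xs" "set xs \<subseteq> ?G"
    using rtrancl_successively[OF T T0G] by (elim exE conjE)
  then have "sep_chain ?V ?E (Suc k) xs"
    unfolding sep_chain_def T0 Tn by (auto elim: successively_mono)
  then show ?thesis by (rule exI)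
qed


section \<open>Labelling along disjoint paths\<close>

definition strong :: "('a \<times> 'a) set \<Rightarrow> 'a set \<Rightarrow> bool" where
  "strong E U \<longleftrightarrow> (\<forall>a\<in>U. \<forall>b\<in>U. (a, b) \<in> (E \<inter> U \<times> U)\<^sup>*)"

text \<open>Chords are excluded in the forward direction only: a backward edge is what closes the
  path into a strongly connected set.\<close>

definition induced_path :: "('a \<times> 'a) set \<Rightarrow> (nat \<Rightarrow> 'a) \<Rightarrow> nat \<Rightarrow> bool" where
  "induced_path E Q N \<longleftrightarrow> (\<forall>c<N. (Q c, Q (Suc c)) \<in> E) \<and> inj_on Q {..N} \<and>
     (\<forall>c c'. c + 2 \<le> c' \<and> c' \<le> N \<longrightarrow> (Q c, Q c') \<notin> E)"

lemma path_relpow: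
  assumes "\<And>c. c < N \<Longrightarrow> (Q c, Q (Suc c)) \<in> R" "i \<le> j" "j \<le> N"
  shows "(Q i, Q j) \<in> R ^^ (j - i)"
  using assms(2,3)
proof (induction j rule: dec_induct)
  case (step j)
  then have "(Q i, Q (Suc j)) \<in> R ^^ (Suc (j - i))"
    using assms(1)[of j] by auto
  then show ?case using step by (simp add: Suc_diff_le)
qed simp

text \<open>A walk of least length inside \<open>U\<close> will do, since a repeated vertex or a
  forward chord would shorten it.\<close>

lemma induced_path_exists:
  assumes path: "(x, z) \<in> (E \<inter> U \<times> U)\<^sup>*" and x: "x \<in> U"
  shows "\<exists>Q N. Q 0 = x \<and> Q N = z \<and> (\<forall>c\<le>N. Q c \<in> U) \<and> induced_path E Q N"
proof -
  let ?R = "E \<inter> U \<times> U"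
  define N where "N = (LEAST N. (x, z) \<in> ?R ^^ N)"
  have "\<exists>N. (x, z) \<in> ?R ^^ N" using path by (simp add: rtrancl_power)
  then have N: "(x, z) \<in> ?R ^^ N" unfolding N_def by (rule LeastI_ex)
  have least: "N \<le> m" if "(x, z) \<in> ?R ^^ m" for m unfolding N_def using that by (rule Least_le)
  obtain Q where Q: "Q 0 = x" "Q N = z" "\<And>c. c < N \<Longrightarrow> (Q c, Q (Suc c)) \<in> ?R"
    using N unfolding relpow_fun_conv by blast
  have QU: "Q c \<in> U" if "c \<le> N" for c
    using that Q(1) x Q(3)[of "c - 1"] by (cases c) auto
  have pre: "(x, Q i) \<in> ?R ^^ i" if "i \<le> N" for i
    using path_relpow[of N Q ?R 0 i] Q that by simp
  have suf: "(Q j, z) \<in> ?R ^^ (N - j)" if "j \<le> N" for j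
    using path_relpow[of N Q ?R j N] Q that by simp
  have "inj_on Q {..N}"
  proof (rule linorder_inj_onI)
    fix i j assume ij: "i < j" "i \<in> {..N}" "j \<in> {..N}"
    show "Q i \<noteq> Q j"
    proof
      assume "Q i = Q j"
      then have "(x, z) \<in> ?R ^^ (i + (N - j))"
        unfolding relpow_add using pre[of i] suf[of j] ij by (intro relcompI[of _ "Q j"]) auto
      then show False using least ij by fastforce
    qed
  qed auto
  moreover have "(Q i, Q j) \<notin> E" if ij: "i + 2 \<le> j" "j \<le> N" for i j
  proof
    assume "(Q i, Q j) \<in> E"
    then have "(Q i, Q j) \<in> ?R" using QU ij by auto
    then have "(x, Q j) \<in> ?R ^^ Suc i" using pre[of i] ij by auto
    then have "(x, z) \<in> ?R ^^ (Suc i + (N - j))"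
      unfolding relpow_add using suf[of j] ij by (intro relcompI[of _ "Q j"]) auto
    then show False using least ij by fastforce
  qed
  ultimately show ?thesis using Q QU unfolding induced_path_def by blast
qed

text \<open>An induced path with at least three vertices is strongly connected, because its last vertex
  is joined to its first one. The parity argument below excludes paths with two vertices.\<close>

lemma strong_induced_subpath:
  assumes Q: "induced_path E Q N" and QV: "\<And>c. c \<le> N \<Longrightarrow> Q c \<in> V"
    and semi: "\<And>u v. u \<in> V \<Longrightarrow> v \<in> V \<Longrightarrow> u \<noteq> v \<Longrightarrow> (u, v) \<in> E \<or> (v, u) \<in> E"
    and c: "c \<le> c'" "c' \<le> N" "even c = even c'"
  shows "strong E (Q ` {c..c'})"
proof -
  let ?U = "Q ` {c..c'}"
  let ?R = "E \<inter> ?U \<times> ?U"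
  have fwd: "(Q i, Q j) \<in> ?R\<^sup>*" if "c \<le> i" "i \<le> j" "j \<le> c'" for i j
    using that(2,3)
  proof (induction j rule: dec_induct)
    case (step j)
    then have "(Q j, Q (Suc j)) \<in> ?R" using Q c(2) that(1) by (auto simp: induced_path_def)
    with step show ?case by (meson Suc_leD rtrancl.rtrancl_into_rtrancl)
  qed simp
  have closing: "(Q c', Q c) \<in> ?R\<^sup>*"
  proof (cases "c = c'")
    case False
    have cc: "c + 2 \<le> c'" using c False by presburger
    have "(Q c, Q c') \<notin> E" using Q cc c by (simp add: induced_path_def)
    moreover have "Q c \<noteq> Q c'"
      using Q c False inj_on_eq_iff[of Q "{..N}" c c'] by (simp add: induced_path_def)
    ultimately have "(Q c', Q c) \<in> E" using semi[of "Q c" "Q c'"] QV c by auto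
    then show ?thesis using c by auto
  qed simp
  have "(Q i, Q j) \<in> ?R\<^sup>*" if "c \<le> i" "i \<le> c'" "c \<le> j" "j \<le> c'" for i j
    using fwd[of i c'] closing fwd[of c j] that by (meson order_refl rtrancl_trans)
  then show ?thesis by (auto simp: strong_def)
qed

locale sep_sequence =
  fixes V :: "'a set" and E :: "('a \<times> 'a) set" and n :: nat and S :: "nat \<Rightarrow> 'a \<Rightarrow> nat"
  assumes finite_V: "finite V" and E_subset: "E \<subseteq> V \<times> V"
    and semicomplete: "u \<in> V \<Longrightarrow> v \<in> V \<Longrightarrow> u \<noteq> v \<Longrightarrow> (u, v) \<in> E \<or> (v, u) \<in> E"
    and S_0: "S 0 = (\<lambda>v. if v \<in> V then 2 else 0)" and S_n: "S n = (\<lambda>v. 0)"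
    and S_step: "p < n \<Longrightarrow> step V (S p) (S (Suc p))"
    and S_seps: "p \<le> n \<Longrightarrow> S p \<in> seps V E"
begin

abbreviation M :: "nat \<Rightarrow> 'a set" where "M p \<equiv> middle V (S p)"

abbreviation lev :: "nat \<Rightarrow> nat" where "lev p \<equiv> card (M p)"

lemma finite_M [simp]: "finite (M p)"
  using finite_V by (rule finite_middle)

lemma S_antimono:
  assumes "p \<le> q" "q \<le> n" shows "S q v \<le> S p v"
  using assms
proof (induction q rule: dec_induct)
  case (step q)
  have "S (Suc q) v \<le> S q v" using step_le[OF S_step[of q]] step by (auto simp: le_fun_def)
  with step show ?case by auto
qed simp

lemma S_le_2: "p \<le> n \<Longrightarrow> S p v \<le> 2"
  using S_seps[of p] by (auto simp: seps_def split: if_splits)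

lemma S_jump: "p \<le> n \<Longrightarrow> (u, v) \<in> E \<Longrightarrow> S p u = 0 \<Longrightarrow> S p v < 2"
  using S_seps[of p] by (auto simp: seps_def sep_def)

lemma M_0: "M 0 = {}" and M_n: "M n = {}"
  by (auto simp: middle_def S_0 S_n)

lemma S_stepE:
  assumes "p < n"
  obtains v where "v \<in> V" "0 < S p v" "S (Suc p) = (S p)(v := S p v - 1)"
  using S_step[OF assms] by (auto simp: step_def)

lemma S_step_unique:
  assumes "p < n" "S (Suc p) u \<noteq> S p u" "S (Suc p) v \<noteq> S p v"
  shows "u = v"
  using assms by (metis S_stepE fun_upd_other)

text \<open>The one vertex that changes either enters the middle (2 to 1) or leaves it (1 to 0).
  This makes every letter of the word either an opening or a closing one.\<close>

lemma lev_step: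
  assumes "p < n"
  shows "lev (Suc p) = lev p + 1 \<or> lev p = lev (Suc p) + 1"
proof -
  obtain v where v: "v \<in> V" "0 < S p v" "S (Suc p) = (S p)(v := S p v - 1)"
    using S_stepE[OF assms] .
  have "S p v \<le> 2" using S_le_2 assms by simp
  with v(2) consider "S p v = 1" | "S p v = 2" by linarith
  then show ?thesis
  proof cases
    case 1
    then have "v \<in> M p" "M (Suc p) = M p - {v}" using v by (auto simp: middle_def split: if_splits)
    then have "lev p = lev (Suc p) + 1" using finite_M[of p] by (metis Suc_eq_plus1 card_Suc_Diff1)
    then show ?thesis ..
  next
    case 2
    then have "v \<notin> M p" "M (Suc p) = insert v (M p)" using v by (auto simp: middle_def split: if_splits)
    then show ?thesis using finite_M[of p] by simp
  qed
qed

end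

text \<open>The interface between paths and words. Labels name the middle vertices in such a way
  that equal labels at the two ends of a Dyck stretch are joined through \<open>U l\<close>, and
  \<open>par\<close> is the parity information that decides strong connectivity. Keeping
  \<open>U l\<close> off the left side of \<open>S p\<close> and the right side of
  \<open>S q\<close> is what later separates the branch sets of different gaps.\<close>

locale labelled_sequence = sep_sequence +
  fixes y :: "nat \<Rightarrow> nat \<Rightarrow> 'a" and par :: "nat \<Rightarrow> nat set"
  assumes y_bij: "p \<le> n \<Longrightarrow> bij_betw (y p) {..<lev p} (M p)"
    and par_subset: "p \<le> n \<Longrightarrow> par p \<subseteq> {..<lev p}"
    and gap: "p \<le> q \<Longrightarrow> q \<le> n \<Longrightarrow> lev p = lev q \<Longrightarrow> (\<And>m. p \<le> m \<Longrightarrow> m \<le> q \<Longrightarrow> lev p \<le> lev m) \<Longrightarrow>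
      \<exists>U. \<forall>l<lev p. y p l \<in> U l \<and> y q l \<in> U l \<and> U l \<subseteq> {v \<in> V. 1 \<le> S p v \<and> S q v \<le> 1} \<and>
        (\<forall>l'<lev p. l \<noteq> l' \<longrightarrow> U l \<inter> U l' = {}) \<and> ((l \<in> par p \<longleftrightarrow> l \<in> par q) \<longrightarrow> strong E (U l))"

locale linked_sequence = sep_sequence +
  assumes linked: "p \<le> q \<Longrightarrow> q \<le> n \<Longrightarrow> s \<in> seps V E \<Longrightarrow> S q \<le> s \<Longrightarrow> s \<le> S p \<Longrightarrow>
    (\<And>m. p \<le> m \<Longrightarrow> m \<le> q \<Longrightarrow> t \<le> lev m) \<Longrightarrow> t \<le> card (middle V s)"
begin

definition path_system :: "nat \<Rightarrow> nat \<Rightarrow> (nat \<Rightarrow> nat \<Rightarrow> 'a) \<Rightarrow> (nat \<Rightarrow> nat) \<Rightarrow> bool" where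
  "path_system a b Q N \<longleftrightarrow>
     (\<forall>l<lev a. Q l 0 \<in> M a \<and> Q l (N l) \<in> M b \<and> (\<forall>c\<le>N l. Q l c \<in> V) \<and> induced_path E (Q l) (N l)) \<and>
     (\<forall>l<lev a. \<forall>l'<lev a. \<forall>c\<le>N l. \<forall>c'\<le>N l'. Q l c = Q l' c' \<longrightarrow> l = l')"

lemma path_systemD:
  assumes "path_system a b Q N" "l < lev a"
  shows "Q l 0 \<in> M a" "Q l (N l) \<in> M b" "c \<le> N l \<Longrightarrow> Q l c \<in> V" "induced_path E (Q l) (N l)"
    "l' < lev a \<Longrightarrow> c \<le> N l \<Longrightarrow> c' \<le> N l' \<Longrightarrow> Q l c = Q l' c' \<Longrightarrow> l = l'"
  using assms unfolding path_system_def by blast+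

lemma path_system_exists:
  assumes ab: "a \<le> b" "b \<le> n" "lev a = lev b" and lev: "\<And>m. a \<le> m \<Longrightarrow> m \<le> b \<Longrightarrow> lev a \<le> lev m"
  shows "\<exists>Q N. path_system a b Q N"
proof -
  have "\<exists>g U. linkage V E (M a) (M b) g U"
  proof (rule Menger_equicardinal[OF finite_V E_subset _ _ HOL.refl])
    show "M a \<subseteq> V" "M b \<subseteq> V" by (auto simp: middle_def)
    show "lev b = lev a" using ab by simp
    fix s :: "'a \<Rightarrow> nat"
    assume s: "sep E s" "\<forall>x\<in>M a. s x \<le> 1" "\<forall>y\<in>M b. 1 \<le> s y"
    define r where "r v = (if v \<in> V then min 2 (s v) else 0)" for v
    have r: "r \<in> seps V E"
      using s(1) E_subset by (auto simp: seps_def sep_def r_def min_less_iff_disj)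
    \<comment> \<open>Clamping \<open>r\<close> between \<open>S b\<close> and \<open>S a\<close>
      makes linkedness applicable and creates no new middle vertex: where the value 1 comes from
      \<open>S a\<close> or \<open>S b\<close>, the vertex is in \<open>M a\<close> or
      \<open>M b\<close>, and the bounds on \<open>s\<close> there leave only
      \<open>s v = 1\<close>.\<close>
    define q where "q = sup (inf r (S a)) (S b)"
    have q: "q \<in> seps V E"
      unfolding q_def using r S_seps ab by (intro seps_sup seps_inf) auto
    have ba: "S b v \<le> S a v" for v using S_antimono ab by auto
    have "lev a \<le> card (middle V q)"
    proof (rule linked[of a b])
      show "S b \<le> q" "q \<le> S a"
        using ba by (auto simp: q_def le_fun_def sup_nat_def inf_nat_def)
    qed (use ab q lev in auto)
    also have "middle V q \<subseteq> middle V s"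
    proof
      fix v assume v: "v \<in> middle V q"
      then have vV: "v \<in> V" and qv: "max (min (min 2 (s v)) (S a v)) (S b v) = 1"
        by (auto simp: middle_def q_def r_def sup_nat_def inf_nat_def)
      have "S a v = 1 \<longrightarrow> s v \<le> 1" "S b v = 1 \<longrightarrow> 1 \<le> s v"
        using s(2,3) vV by (auto simp: middle_def)
      then have "s v = 1" using qv ba[of v] by (auto simp: max_def min_def split: if_splits)
      then show "v \<in> middle V s" using vV by (simp add: middle_def)
    qed
    then have "card (middle V q) \<le> card (middle V s)" by (rule card_mono[OF finite_middle[OF finite_V]])
    finally show "lev a \<le> card (middle V s)" .
  qed
  then obtain g U where L: "linkage V E (M a) (M b) g U" by blast
  obtain e where e: "bij_betw e {..<lev a} (M a)"
    using ex_bij_betw_nat_finite[OF finite_M[of a]] by (auto simp: atLeast0LessThan)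
  have "\<exists>Q N. Q 0 = e l \<and> Q N = g (e l) \<and> (\<forall>c\<le>N. Q c \<in> U (e l)) \<and> induced_path E Q N" if "l < lev a" for l
    using L bij_betw_apply[OF e, of l] that unfolding linkage_def by (intro induced_path_exists) auto
  then obtain Q N where QN: "\<And>l. l < lev a \<Longrightarrow> Q l 0 = e l \<and> Q l (N l) = g (e l) \<and>
      (\<forall>c\<le>N l. Q l c \<in> U (e l)) \<and> induced_path E (Q l) (N l)"
    by metis
  have "path_system a b Q N"
    unfolding path_system_def
  proof (intro conjI allI impI)
    fix l assume l: "l < lev a"
    have el: "e l \<in> M a" using bij_betw_apply[OF e, of l] l by simp
    show "Q l 0 \<in> M a" using QN[OF l] el by simp
    show "Q l (N l) \<in> M b" using QN[OF l] el L by (auto simp: linkage_def dest: bij_betw_apply)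
    show "Q l c \<in> V" if "c \<le> N l" for c
      using QN[OF l] el L that unfolding linkage_def by blast
    show "induced_path E (Q l) (N l)" using QN[OF l] by simp
    fix l' c c' assume *: "l' < lev a" "c \<le> N l" "c' \<le> N l'" "Q l c = Q l' c'"
    have el': "e l' \<in> M a" using bij_betw_apply[OF e, of l'] * by simp
    have "Q l c \<in> U (e l) \<inter> U (e l')" using QN[OF l] QN[of l'] * by auto
    then have "e l = e l'" using L el el' unfolding linkage_def by blast
    then show "l = l'" using bij_betw_imp_inj_on[OF e] l * by (auto simp: inj_on_def)
  qed
  then show ?thesis by blast
qed

text \<open>\<open>first p\<close> and \<open>final p\<close> bound the longest interval around
  \<open>p\<close> on which the order stays at least \<open>lev p\<close>. All positions of that
  same order in the interval share its path system, and this makes their labels consistent.\<close>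

definition first :: "nat \<Rightarrow> nat" where
  "first p = (LEAST a. a \<le> p \<and> (\<forall>m. a \<le> m \<and> m \<le> p \<longrightarrow> lev p \<le> lev m))"

definition final :: "nat \<Rightarrow> nat" where
  "final p = (GREATEST b. p \<le> b \<and> b \<le> n \<and> (\<forall>m. p \<le> m \<and> m \<le> b \<longrightarrow> lev p \<le> lev m))"

lemma first: "first p \<le> p" "first p \<le> m \<Longrightarrow> m \<le> p \<Longrightarrow> lev p \<le> lev m"
  and first_le: "a \<le> p \<Longrightarrow> (\<And>m. a \<le> m \<Longrightarrow> m \<le> p \<Longrightarrow> lev p \<le> lev m) \<Longrightarrow> first p \<le> a"
proof -
  let ?P = "\<lambda>a. a \<le> p \<and> (\<forall>m. a \<le> m \<and> m \<le> p \<longrightarrow> lev p \<le> lev m)"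
  have "?P p" by auto
  then have "?P (first p)" unfolding first_def by (rule LeastI)
  then show "first p \<le> p" "first p \<le> m \<Longrightarrow> m \<le> p \<Longrightarrow> lev p \<le> lev m" by auto
  show "first p \<le> a" if "a \<le> p" "\<And>m. a \<le> m \<Longrightarrow> m \<le> p \<Longrightarrow> lev p \<le> lev m"
    unfolding first_def by (rule Least_le) (use that in auto)
qed

lemma final:
  assumes "p \<le> n"
  shows "p \<le> final p" "final p \<le> n" "p \<le> m \<Longrightarrow> m \<le> final p \<Longrightarrow> lev p \<le> lev m"
    and le_final: "p \<le> b \<Longrightarrow> b \<le> n \<Longrightarrow> (\<And>m. p \<le> m \<Longrightarrow> m \<le> b \<Longrightarrow> lev p \<le> lev m) \<Longrightarrow> b \<le> final p"
proof -
  let ?P = "\<lambda>b. p \<le> b \<and> b \<le> n \<and> (\<forall>m. p \<le> m \<and> m \<le> b \<longrightarrow> lev p \<le> lev m)"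
  have "?P p" using assms by auto
  then have "?P (final p)" unfolding final_def by (rule GreatestI_nat[of ?P p n]) auto
  then show "p \<le> final p" "final p \<le> n" "p \<le> m \<Longrightarrow> m \<le> final p \<Longrightarrow> lev p \<le> lev m" by auto
  show "b \<le> final p" if "p \<le> b" "b \<le> n" "\<And>m. p \<le> m \<Longrightarrow> m \<le> b \<Longrightarrow> lev p \<le> lev m"
    unfolding final_def by (rule Greatest_le_nat[of ?P b n]) (use that in auto)
qed

text \<open>Orders change by one per step, so a larger order at \<open>first p\<close> would allow
  the interval to be extended to the left; at position 0 the middle is empty.\<close>

lemma lev_first:
  assumes "p \<le> n" shows "lev (first p) = lev p"
proof (rule antisym)
  show "lev p \<le> lev (first p)" using first[of p] by auto
  show "lev (first p) \<le> lev p"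
  proof (cases "first p")
    case 0
    then show ?thesis by (simp add: M_0)
  next
    case (Suc a)
    have "\<not> lev p \<le> lev a"
    proof
      assume "lev p \<le> lev a"
      then have "lev p \<le> lev m" if "a \<le> m" "m \<le> p" for m
        using first(2)[of p m] that Suc by (cases "m = a") auto
      then have "first p \<le> a" using first_le[of a p] first(1)[of p] Suc by auto
      then show False using Suc by simp
    qed
    then show ?thesis using lev_step[of a] Suc first(1)[of p] assms by auto
  qed
qed

lemma lev_final:
  assumes "p \<le> n" shows "lev (final p) = lev p"
proof (rule antisym)
  show "lev p \<le> lev (final p)" using final[OF assms] by auto
  show "lev (final p) \<le> lev p"
  proof (cases "final p = n")
    case True
    then show ?thesis by (simp add: M_n)
  next
    case False
    then have b: "final p < n" using final(2)[OF assms] by simp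
    have "\<not> lev p \<le> lev (Suc (final p))"
    proof
      assume "lev p \<le> lev (Suc (final p))"
      then have "lev p \<le> lev m" if "p \<le> m" "m \<le> Suc (final p)" for m
        using final(3)[OF assms, of m] that by (cases "m = Suc (final p)") auto
      then have "Suc (final p) \<le> final p"
        using le_final[OF assms, of "Suc (final p)"] final(1)[OF assms] b by auto
      then show False by simp
    qed
    then show ?thesis using lev_step[OF b] by auto
  qed
qed

lemma segment_eq:
  assumes pq: "p \<le> q" "q \<le> n" "lev p = lev q" and lev: "\<And>m. p \<le> m \<Longrightarrow> m \<le> q \<Longrightarrow> lev p \<le> lev m"
  shows "first p = first q" "final p = final q"
proof -
  have pn: "p \<le> n" using pq by simp
  have q1: "first q \<le> first p"
  proof (rule first_le)
    fix m assume "first p \<le> m" "m \<le> q"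
    then show "lev q \<le> lev m" using first(2)[of p m] lev[of m] pq by (cases "m \<le> p") auto
  qed (use first(1)[of p] pq in simp)
  moreover have "first p \<le> first q"
  proof (rule first_le)
    show "first q \<le> p" using q1 first(1)[of p] by simp
    show "lev p \<le> lev m" if "first q \<le> m" "m \<le> p" for m
      using first(2)[of q m] that pq by simp
  qed
  ultimately show "first p = first q" by simp
  have q2: "final q \<le> final p"
  proof (rule le_final[OF pn])
    fix m assume "p \<le> m" "m \<le> final q"
    then show "lev p \<le> lev m" using final(3)[OF pq(2), of m] lev[of m] pq by (cases "m \<le> q") auto
  qed (use final(1,2)[OF pq(2)] pq in auto)
  moreover have "final p \<le> final q"
  proof (rule le_final[OF pq(2)])
    show "q \<le> final p" using q2 final(1)[OF pq(2)] by simp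
    show "lev q \<le> lev m" if "q \<le> m" "m \<le> final p" for m
      using final(3)[OF pn, of m] that pq by simp
  qed (rule final(2)[OF pn])
  ultimately show "final p = final q" by simp
qed

definition cut :: "(nat \<Rightarrow> nat \<Rightarrow> 'a) \<Rightarrow> nat \<Rightarrow> nat \<Rightarrow> nat" where
  "cut Q p l = (LEAST c. 1 \<le> S p (Q l c))"

text \<open>With respect to \<open>S p\<close> each path starts at value at most 1, ends at value at
  least 1 and cannot jump from 0 to 2, so it meets \<open>M p\<close>. As \<open>M p\<close> has
  only as many vertices as there are paths, each path meets it exactly once; a return to value 0
  after the cut would force a second meeting.\<close>

lemma path_system_cut:
  assumes Q: "path_system a b Q N" and pab: "a \<le> p" "p \<le> b" "b \<le> n" and lev: "lev p = lev a"
  shows cut_bij: "bij_betw (\<lambda>l. Q l (cut Q p l)) {..<lev a} (M p)"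
    and cut_le: "l < lev a \<Longrightarrow> cut Q p l \<le> N l"
    and before_cut: "l < lev a \<Longrightarrow> c < cut Q p l \<Longrightarrow> S p (Q l c) = 0"
    and after_cut: "l < lev a \<Longrightarrow> cut Q p l \<le> c \<Longrightarrow> c \<le> N l \<Longrightarrow> 1 \<le> S p (Q l c)"
proof -
  have pn: "p \<le> n" using pab by simp
  have start: "S p (Q l 0) \<le> 1" if "l < lev a" for l
  proof -
    have "S a (Q l 0) = 1" using path_systemD(1)[OF Q that] by (simp add: middle_def)
    then show ?thesis using S_antimono[of a p "Q l 0"] pab pn by simp
  qed
  have stop: "1 \<le> S p (Q l (N l))" if "l < lev a" for l
  proof -
    have "S b (Q l (N l)) = 1" using path_systemD(2)[OF Q that] by (simp add: middle_def)
    then show ?thesis using S_antimono[of p b "Q l (N l)"] pab by simp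
  qed
  show cut_le: "cut Q p l \<le> N l" if "l < lev a" for l
    unfolding cut_def using stop[OF that] by (rule Least_le)
  show before: "S p (Q l c) = 0" if "l < lev a" "c < cut Q p l" for l c
    using not_less_Least[of c "\<lambda>c. 1 \<le> S p (Q l c)"] that by (simp add: cut_def)
  have edge: "(Q l c, Q l (Suc c)) \<in> E" if "l < lev a" "c < N l" for l c
    using path_systemD(4)[OF Q that(1)] that(2) by (simp add: induced_path_def)
  have first_hit: "S p (Q l c) = 1" if "l < lev a" "c \<le> N l" "1 \<le> S p (Q l c)" "0 < c \<longrightarrow> S p (Q l (c - 1)) = 0" for l c
  proof (cases c)
    case 0
    then show ?thesis using start[OF that(1)] that by simp
  next
    case (Suc d)
    then have "S p (Q l c) < 2" using S_jump[OF pn edge[of l d]] that by simp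
    then show ?thesis using that by simp
  qed
  have at_cut: "S p (Q l (cut Q p l)) = 1" if "l < lev a" for l
  proof (rule first_hit[OF that cut_le[OF that]])
    show "1 \<le> S p (Q l (cut Q p l))"
      unfolding cut_def using stop[OF that] by (rule LeastI)
    show "0 < cut Q p l \<longrightarrow> S p (Q l (cut Q p l - 1)) = 0" using before[OF that] by simp
  qed
  note QV = path_systemD(3)[OF Q]
  have disj: "l = l'" if "Q l c = Q l' c'" "l < lev a" "l' < lev a" "c \<le> N l" "c' \<le> N l'" for l l' c c'
    by (rule path_systemD(5)[OF Q that(2,3,4,5,1)])
  let ?h = "\<lambda>l. Q l (cut Q p l)"
  have inj: "inj_on ?h {..<lev a}"
    using disj cut_le by (auto simp: inj_on_def)
  moreover have sub: "?h ` {..<lev a} \<subseteq> M p"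
    using at_cut QV cut_le by (auto simp: middle_def)
  ultimately have "?h ` {..<lev a} = M p"
    using lev by (intro card_subset_eq) (auto simp: card_image)
  then show bij: "bij_betw ?h {..<lev a} (M p)" using inj by (simp add: bij_betw_def)
  have unique: "c = cut Q p l" if "l < lev a" "c \<le> N l" "S p (Q l c) = 1" for l c
  proof -
    have "Q l c \<in> M p" using that QV by (simp add: middle_def)
    then obtain l' where l': "l' < lev a" "Q l c = ?h l'" using bij_betw_imp_surj_on[OF bij] by blast
    then have "l' = l" using disj[of l c l'] that cut_le by auto
    moreover have "inj_on (Q l) {..N l}"
      using path_systemD(4)[OF Q that(1)] by (simp add: induced_path_def)
    ultimately show ?thesis using l' that cut_le by (auto simp: inj_on_def)
  qed
  show "1 \<le> S p (Q l c)" if l: "l < lev a" and c: "cut Q p l \<le> c" "c \<le> N l" for l c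
  proof (rule ccontr)
    assume z: "\<not> 1 \<le> S p (Q l c)"
    define d where "d = (LEAST d. c < d \<and> 1 \<le> S p (Q l d))"
    have "c \<noteq> N l" using z stop[OF l] by auto
    then have P: "c < N l \<and> 1 \<le> S p (Q l (N l))" using c stop[OF l] by simp
    have d: "c < d" "1 \<le> S p (Q l d)" "d \<le> N l"
      using LeastI[of "\<lambda>d. c < d \<and> 1 \<le> S p (Q l d)", OF P]
        Least_le[of "\<lambda>d. c < d \<and> 1 \<le> S p (Q l d)", OF P] by (auto simp: d_def)
    have "S p (Q l (d - 1)) = 0"
    proof (cases "d - 1 = c")
      case False
      then show ?thesis using not_less_Least[of "d - 1" "\<lambda>d. c < d \<and> 1 \<le> S p (Q l d)"] d by (auto simp: d_def)
    qed (use z in simp)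
    then have "S p (Q l d) = 1" using first_hit[OF l d(3,2)] by simp
    then have "d = cut Q p l" using unique l d by simp
    then show False using d c by simp
  qed
qed

theorem labelling_exists: "\<exists>y par. labelled_sequence V E n S y par"
proof -
  have ex: "\<exists>Q N. path_system (first p) (final p) Q N" if "p \<le> n" for p
  proof (rule path_system_exists)
    have f: "first p \<le> p" "p \<le> final p" "final p \<le> n" using first final that by auto
    then show "first p \<le> final p" "final p \<le> n" by auto
    show "lev (first p) = lev (final p)" using lev_first lev_final that by simp
    show "lev (first p) \<le> lev m" if "first p \<le> m" "m \<le> final p" for m
      using first(2)[of p m] final(3)[OF \<open>p \<le> n\<close>, of m] lev_first[OF \<open>p \<le> n\<close>] that by (cases "m \<le> p") auto
  qed
  \<comment> \<open>The choice depends on the two end positions only, so that all positions with the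
    same interval use literally the same paths.\<close>
  define Q0 where "Q0 a b = (SOME Q. \<exists>N. path_system a b Q N)" for a b
  define N0 where "N0 a b = (SOME N. path_system a b (Q0 a b) N)" for a b
  have QN0: "path_system a b (Q0 a b) (N0 a b)" if "\<exists>Q N. path_system a b Q N" for a b
  proof -
    have "\<exists>N. path_system a b (Q0 a b) N" unfolding Q0_def using that by (rule someI_ex)
    then show ?thesis unfolding N0_def by (rule someI_ex)
  qed
  define Q where "Q p = Q0 (first p) (final p)" for p
  define N where "N p = N0 (first p) (final p)" for p
  have QN: "path_system (first p) (final p) (Q p) (N p)" if "p \<le> n" for p
    using QN0[OF ex[OF that]] by (simp add: Q_def N_def)
  define y where "y p l = Q p l (cut (Q p) p l)" for p l
  \<comment> \<open>For two cuts of one path, equal parity means that they coincide or are at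
    distance at least two.\<close>
  define par where "par p = {l. l < lev p \<and> even (cut (Q p) p l)}" for p
  have "labelled_sequence V E n S y par"
  proof unfold_locales
    fix p assume p: "p \<le> n"
    show "bij_betw (y p) {..<lev p} (M p)"
      using cut_bij[OF QN[OF p] first(1) final(1,2)[OF p]] lev_first[OF p] by (simp add: y_def[abs_def])
    show "par p \<subseteq> {..<lev p}" by (auto simp: par_def)
  next
    fix p q
    assume pq: "p \<le> q" "q \<le> n" "lev p = lev q" and lev: "\<And>m. p \<le> m \<Longrightarrow> m \<le> q \<Longrightarrow> lev p \<le> lev m"
    have p: "p \<le> n" using pq by simp
    note seg = segment_eq[OF pq lev]
    have Qq: "Q q = Q p" "N q = N p" by (simp_all add: Q_def N_def seg)
    note ps = QN[OF p]
    have la: "lev (first p) = lev p" by (rule lev_first[OF p])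
    have fp: "first p \<le> p" "p \<le> final p" "final p \<le> n" "first p \<le> q" "q \<le> final p"
      using first(1)[of p] first(1)[of q] final[OF p] final(1)[OF pq(2)] seg by auto
    note cp = path_system_cut[OF ps fp(1,2,3) la[symmetric], unfolded la]
    note cq = path_system_cut[OF ps fp(4,5,3) trans[OF pq(3)[symmetric] la[symmetric]], unfolded la]
    define U where "U l = Q p l ` {cut (Q p) p l..cut (Q p) q l}" for l
    \<comment> \<open>Values never increase with time, so a vertex off the left side at
      \<open>q\<close> was already off it at \<open>p\<close>.\<close>
    have cut_mono: "cut (Q p) p l \<le> cut (Q p) q l" if l: "l < lev p" for l
    proof (rule ccontr)
      assume "\<not> ?thesis"
      then have "S p (Q p l (cut (Q p) q l)) = 0" using cp(3)[OF l] by simp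
      moreover have "1 \<le> S q (Q p l (cut (Q p) q l))" using cq(4)[OF l order_refl cq(2)[OF l]] .
      ultimately show False using S_antimono[OF pq(1,2), of "Q p l (cut (Q p) q l)"] by simp
    qed
    note QV = path_systemD(3)[OF ps, unfolded la]
    have "y p l \<in> U l \<and> y q l \<in> U l \<and> U l \<subseteq> {v \<in> V. 1 \<le> S p v \<and> S q v \<le> 1} \<and>
        (\<forall>l'<lev p. l \<noteq> l' \<longrightarrow> U l \<inter> U l' = {}) \<and> ((l \<in> par p \<longleftrightarrow> l \<in> par q) \<longrightarrow> strong E (U l))"
      if l: "l < lev p" for l
    proof (intro conjI allI impI)
      show "y p l \<in> U l" "y q l \<in> U l" using cut_mono[OF l] by (auto simp: U_def y_def Qq)
      show "U l \<subseteq> {v \<in> V. 1 \<le> S p v \<and> S q v \<le> 1}"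
      proof
        fix v assume "v \<in> U l"
        then obtain c where c: "cut (Q p) p l \<le> c" "c \<le> cut (Q p) q l" "v = Q p l c"
          by (auto simp: U_def)
        have cN: "c \<le> N p l" using c(2) cq(2)[OF l] by simp
        have "1 \<le> S p v" using cp(4)[OF l c(1) cN] c(3) by simp
        moreover have "S q v \<le> 1"
        proof (cases "c = cut (Q p) q l")
          case True
          then have "v \<in> M q" using bij_betw_apply[OF cq(1), of l] l c(3) by simp
          then show ?thesis by (simp add: middle_def)
        next
          case False
          then show ?thesis using cq(3)[OF l, of c] c by simp
        qed
        ultimately show "v \<in> {v \<in> V. 1 \<le> S p v \<and> S q v \<le> 1}" using QV[OF l cN] c(3) by simp
      qed
      show "U l \<inter> U l' = {}" if l': "l' < lev p" "l \<noteq> l'" for l'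
      proof (rule ccontr)
        assume "U l \<inter> U l' \<noteq> {}"
        then obtain c c' where "c \<le> cut (Q p) q l" "c' \<le> cut (Q p) q l'" "Q p l c = Q p l' c'"
          by (auto simp: U_def)
        then have "l = l'"
          using path_systemD(5)[OF ps, unfolded la, OF l l'(1), of c c'] cq(2)[OF l] cq(2)[OF l'(1)]
          by linarith
        then show False using l' by simp
      qed
      assume par: "l \<in> par p \<longleftrightarrow> l \<in> par q"
      show "strong E (U l)"
        unfolding U_def
      proof (rule strong_induced_subpath[OF _ QV[OF l] semicomplete])
        show "induced_path E (Q p l) (N p l)" by (rule path_systemD(4)[OF ps, unfolded la, OF l])
        show "even (cut (Q p) p l) = even (cut (Q p) q l)"
          using par l pq(3) by (simp add: par_def Qq)
      qed (use cut_mono[OF l] cq(2)[OF l] in auto)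
    qed
    then show "\<exists>U. \<forall>l<lev p. y p l \<in> U l \<and> y q l \<in> U l \<and> U l \<subseteq> {v \<in> V. 1 \<le> S p v \<and> S q v \<le> 1} \<and>
        (\<forall>l'<lev p. l \<noteq> l' \<longrightarrow> U l \<inter> U l' = {}) \<and> ((l \<in> par p \<longleftrightarrow> l \<in> par q) \<longrightarrow> strong E (U l))"
      by blast
  qed
  then show ?thesis by blast
qed

end

lemma linked_sequence_of_sep_chain:
  assumes "finite V" "E \<subseteq> V \<times> V" "\<And>u v. u \<in> V \<Longrightarrow> v \<in> V \<Longrightarrow> u \<noteq> v \<Longrightarrow> (u, v) \<in> E \<or> (v, u) \<in> E"
    and xs: "sep_chain V E K xs" "successively (step V) xs" "linked V E xs"
  shows "linked_sequence V E (length xs - 1) (\<lambda>p. xs ! p)"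
proof
  have ne: "xs \<noteq> []" using xs(1) by (simp add: sep_chain_def)
  then have less: "p < length xs" if "p \<le> length xs - 1" for p
    using that by (cases xs) auto
  show "xs ! 0 = (\<lambda>v. if v \<in> V then 2 else 0)" "xs ! (length xs - 1) = (\<lambda>v. 0)"
    using xs(1) ne by (auto simp: sep_chain_def hd_conv_nth last_conv_nth)
  show "step V (xs ! p) (xs ! Suc p)" if "p < length xs - 1" for p
    using xs(2) that by (auto simp: successively_conv_nth)
  show "xs ! p \<in> seps V E" if "p \<le> length xs - 1" for p
    using xs(1) less[OF that] by (auto simp: sep_chain_def)
  show "t \<le> card (middle V s)"
    if "p \<le> q" "q \<le> length xs - 1" "s \<in> seps V E" "xs ! q \<le> s" "s \<le> xs ! p"
      "\<And>m. p \<le> m \<Longrightarrow> m \<le> q \<Longrightarrow> t \<le> card (middle V (xs ! m))" for p q s t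
    using xs(3) that less[of q] unfolding linked_def by blast
qed (use assms in auto)


section \<open>From embedded words to branch sets\<close>

lemma strong_Un:
  assumes "strong E A" "strong E B" "A \<inter> B \<noteq> {}"
  shows "strong E (A \<union> B)"
proof -
  let ?R = "E \<inter> (A \<union> B) \<times> (A \<union> B)"
  obtain x where x: "x \<in> A" "x \<in> B" using assms(3) by blast
  have "(a, x) \<in> ?R\<^sup>* \<and> (x, a) \<in> ?R\<^sup>*" if "a \<in> A \<union> B" for a
  proof -
    have "(E \<inter> A \<times> A)\<^sup>* \<subseteq> ?R\<^sup>*" "(E \<inter> B \<times> B)\<^sup>* \<subseteq> ?R\<^sup>*" by (auto intro!: rtrancl_mono)
    with assms(1,2) x that show ?thesis unfolding strong_def by blast
  qed
  then show ?thesis unfolding strong_def by (meson rtrancl_trans)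
qed

lemma strong_UN_chain:
  assumes "a < b" "\<And>i. a \<le> i \<Longrightarrow> i < b \<Longrightarrow> strong E (A i)"
    and "\<And>i. a \<le> i \<Longrightarrow> Suc i < b \<Longrightarrow> A i \<inter> A (Suc i) \<noteq> {}"
  shows "strong E (\<Union>i\<in>{a..<b}. A i)"
proof -
  have "Suc a \<le> b" using assms(1) by simp
  then show ?thesis using assms(2,3)
  proof (induction b rule: dec_induct)
    case base
    then show ?case by simp
  next
    case (step b)
    have "strong E ((\<Union>i\<in>{a..<b}. A i) \<union> A b)"
    proof (rule strong_Un)
      show "strong E (\<Union>i\<in>{a..<b}. A i)" using step by simp
      have "A (b - 1) \<inter> A b \<noteq> {}" using step.prems(2)[of "b - 1"] step.hyps by simp
      moreover have "b - 1 \<in> {a..<b}" using step.hyps by auto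
      ultimately show "(\<Union>i\<in>{a..<b}. A i) \<inter> A b \<noteq> {}" by blast
    qed (use step in simp)
    moreover have "{a..<Suc b} = insert b {a..<b}" using step.hyps by auto
    ultimately show ?case by (simp add: Un_commute)
  qed
qed

section \<open>Lifetimes of vertices in the middle\<close>

context sep_sequence
begin

definition enter :: "'a \<Rightarrow> nat" where "enter v = (LEAST p. S p v \<le> 1)"

definition leave :: "'a \<Rightarrow> nat" where "leave v = (LEAST p. S p v = 0)"

lemma S_drop: "p < n \<Longrightarrow> S p v \<le> S (Suc p) v + 1"
  by (elim S_stepE) auto

lemma enter_leave:
  assumes v: "v \<in> V"
  shows "0 < enter v" "enter v < leave v" "leave v \<le> n"
    and S_eq: "p \<le> n \<Longrightarrow> S p v = (if p < enter v then 2 else if p < leave v then 1 else 0)"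
proof -
  have n: "S n v \<le> 1" "S n v = 0" by (simp_all add: S_n)
  have e: "S (enter v) v \<le> 1" "enter v \<le> n"
    unfolding enter_def using n(1) by (rule LeastI, rule Least_le)
  have l: "S (leave v) v = 0" "leave v \<le> n"
    unfolding leave_def using n(2) by (rule LeastI, rule Least_le)
  have be: "S p v = 2" if "p < enter v" for p
    using not_less_Least[of p "\<lambda>p. S p v \<le> 1"] S_le_2[of p v] that e by (auto simp: enter_def)
  have bl: "0 < S p v" if "p < leave v" for p
    using not_less_Least[of p "\<lambda>p. S p v = 0"] that by (auto simp: leave_def)
  show e0: "0 < enter v"
  proof (rule ccontr)
    assume "\<not> 0 < enter v"
    then show False using e S_0 v by simp
  qed
  have "1 \<le> S (enter v) v"
    using be[of "enter v - 1"] S_drop[of "enter v - 1" v] e e0 by simp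
  then have "S (enter v) v \<noteq> 0" by simp
  then have "enter v \<noteq> leave v" using l by auto
  moreover have "enter v \<le> leave v" unfolding enter_def by (rule Least_le) (simp add: l)
  ultimately show "enter v < leave v" by simp
  show "leave v \<le> n" by (rule l)
  show "S p v = (if p < enter v then 2 else if p < leave v then 1 else 0)" if p: "p \<le> n"
  proof (cases "p < enter v")
    case False
    then have "S p v \<le> 1" using S_antimono[of "enter v" p v] e p by simp
    moreover have "S p v = 0" if "leave v \<le> p" using S_antimono[of "leave v" p v] l p that by simp
    ultimately show ?thesis using bl[of p] False by auto
  qed (use be in simp)
qed

lemma M_iff: "p \<le> n \<Longrightarrow> v \<in> M p \<longleftrightarrow> v \<in> V \<and> enter v \<le> p \<and> p < leave v"
  using S_eq[of v p] enter_leave[of v] by (auto simp: middle_def split: if_splits)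

lemma leave_neq_enter:
  assumes V: "u \<in> V" "v \<in> V" and "u \<noteq> v"
  shows "leave u \<noteq> enter v"
proof
  assume eq: "leave u = enter v"
  define p where "p = leave u - 1"
  have p: "p < n" "Suc p = leave u" using enter_leave[OF V(1)] by (auto simp: p_def)
  have "S (Suc p) u \<noteq> S p u"
    using S_eq[OF V(1), of p] S_eq[OF V(1), of "Suc p"] p enter_leave[OF V(1)] by simp
  moreover have "S (Suc p) v \<noteq> S p v"
    using S_eq[OF V(2), of p] S_eq[OF V(2), of "Suc p"] p eq enter_leave[OF V(2)] by simp
  ultimately show False using S_step_unique[OF p(1)] assms by blast
qed

text \<open>If \<open>u\<close> had left before \<open>v\<close> entered, the edge would lead from
  value 0 to value 2. Entering and leaving times of distinct vertices never coincide, since each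
  step moves a single vertex.\<close>

lemma edge_cases:
  assumes uv: "(u, v) \<in> E" "u \<noteq> v"
  shows "(\<exists>p<n. u \<in> M p \<and> v \<in> M p) \<or> leave v < enter u"
proof -
  have V: "u \<in> V" "v \<in> V" using uv E_subset by auto
  note u = enter_leave[OF V(1)] and v = enter_leave[OF V(2)]
  have "\<not> leave u < enter v"
    using S_jump[of "leave u" u v] uv u v by auto
  moreover have "leave u \<noteq> enter v" "leave v \<noteq> enter u"
    using leave_neq_enter V uv(2) by auto
  moreover have ?thesis if "enter v < leave u" "enter u < leave v"
  proof -
    define p where "p = max (enter u) (enter v)"
    have "p < n" "u \<in> M p" "v \<in> M p"
      using that u v V M_iff[of p] by (auto simp: p_def)
    then show ?thesis by blast
  qed
  ultimately show ?thesis
    using linorder_neqE_nat[of "leave u" "enter v"] linorder_neqE_nat[of "leave v" "enter u"] by blast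
qed

end

type_synonym info = "nat \<times> nat set \<times> (nat \<times> nat) set"

context labelled_sequence
begin

definition info :: "nat \<Rightarrow> info" where
  "info p = (lev p, par p, {(l, l'). l < lev p \<and> l' < lev p \<and> (y p l, y p l') \<in> E})"

text \<open>Both ends of the step are described: a matched letter thereby fixes the information at
  the end of the gap before it and at the start of the gap after it. The third component tells which
  labels at the two ends name the same vertex.\<close>

definition letter :: "nat \<Rightarrow> info \<times> info \<times> (nat \<times> nat) set" where
  "letter p = (info p, info (Suc p), {(l, l'). l < lev p \<and> l' < lev (Suc p) \<and> y p l = y (Suc p) l'})"

definition lab :: "nat \<Rightarrow> 'a \<Rightarrow> nat" where
  "lab p v = inv_into {..<lev p} (y p) v"

lemma lab:
  assumes "p \<le> n" "v \<in> M p"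
  shows "lab p v < lev p" "y p (lab p v) = v"
proof -
  have im: "v \<in> y p ` {..<lev p}" using y_bij[OF assms(1)] assms(2) by (simp add: bij_betw_def)
  show "lab p v < lev p" using inv_into_into[OF im] by (simp add: lab_def)
  show "y p (lab p v) = v" using f_inv_into_f[OF im] by (simp add: lab_def)
qed

lemma y_M: "p \<le> n \<Longrightarrow> l < lev p \<Longrightarrow> y p l \<in> M p"
  using y_bij[of p] by (auto dest: bij_betw_apply)

lemma lab_y: "p \<le> n \<Longrightarrow> l < lev p \<Longrightarrow> lab p (y p l) = l"
  unfolding lab_def using y_bij[of p] by (intro inv_into_f_f) (auto simp: bij_betw_def)

lemma info_ends: "info 0 = (0, {}, {})" "info n = (0, {}, {})"
  using par_subset[of 0] par_subset[of n] by (auto simp: info_def M_0 M_n)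

end

text \<open>Position \<open>i\<close> of the smaller sequence is stretched to the gap from
  \<open>\<alpha> i\<close> to \<open>\<beta> i\<close> of the larger one; only the steps leaving
  some \<open>\<beta> i\<close> with \<open>i < n\<close> are matched.\<close>

locale labelled_embedding =
  A: labelled_sequence V E n S y par + B: labelled_sequence V' E' n' S' y' par'
  for V :: "'a set" and E n S y par and V' :: "'c set" and E' n' S' y' par' +
  fixes \<alpha> \<beta> :: "nat \<Rightarrow> nat"
  assumes \<alpha>_0: "\<alpha> 0 = 0" and \<beta>_n: "\<beta> n = n'"
    and \<alpha>_Suc: "i < n \<Longrightarrow> \<alpha> (Suc i) = Suc (\<beta> i)"
    and letter_eq: "i < n \<Longrightarrow> A.letter i = B.letter (\<beta> i)"
    and \<alpha>_le_\<beta>: "i \<le> n \<Longrightarrow> \<alpha> i \<le> \<beta> i" and \<beta>_le: "i \<le> n \<Longrightarrow> \<beta> i \<le> n'"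
    and gap_ends: "i \<le> n \<Longrightarrow> B.lev (\<alpha> i) = B.lev (\<beta> i)"
    and gap_lev: "i \<le> n \<Longrightarrow> \<alpha> i \<le> m \<Longrightarrow> m \<le> \<beta> i \<Longrightarrow> B.lev (\<alpha> i) \<le> B.lev m"
begin

lemma \<alpha>_le: "i \<le> n \<Longrightarrow> \<alpha> i \<le> n'"
  using \<alpha>_le_\<beta> \<beta>_le le_trans by blast

lemma \<beta>_mono: "i \<le> j \<Longrightarrow> j \<le> n \<Longrightarrow> \<beta> i \<le> \<beta> j"
proof (induction j rule: dec_induct)
  case (step j)
  then show ?case using \<alpha>_Suc[of j] \<alpha>_le_\<beta>[of "Suc j"] by simp
qed simp

lemma \<beta>_less_\<alpha>: "i < j \<Longrightarrow> j \<le> n \<Longrightarrow> \<beta> i < \<alpha> j"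
  by (cases j) (auto simp: \<alpha>_Suc less_Suc_eq_le intro: \<beta>_mono)

text \<open>A position followed by a letter is described by the first component of that letter. At
  the last position, which has none, both middles are empty.\<close>

lemma info_\<beta>: "i \<le> n \<Longrightarrow> A.info i = B.info (\<beta> i)"
  using letter_eq[of i] A.info_ends B.info_ends \<beta>_n
  by (cases "i = n") (auto simp: A.letter_def B.letter_def)

lemma info_\<alpha>: "i \<le> n \<Longrightarrow> A.info i = B.info (\<alpha> i)"
  using letter_eq[of "i - 1"] A.info_ends B.info_ends \<alpha>_0 \<alpha>_Suc[of "i - 1"]
  by (cases i) (auto simp: A.letter_def B.letter_def)

lemma lev_eq:
  assumes "i \<le> n" shows "B.lev (\<alpha> i) = A.lev i" "B.lev (\<beta> i) = A.lev i"
  using info_\<alpha>[OF assms] info_\<beta>[OF assms] by (auto simp: A.info_def B.info_def)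

lemma par_eq:
  assumes "i \<le> n" shows "par' (\<alpha> i) = par i" "par' (\<beta> i) = par i"
  using info_\<alpha>[OF assms] info_\<beta>[OF assms] by (auto simp: A.info_def B.info_def)

lemma adjacent_\<beta>:
  assumes "i \<le> n" "l < A.lev i" "l' < A.lev i" "(y i l, y i l') \<in> E"
  shows "(y' (\<beta> i) l, y' (\<beta> i) l') \<in> E'"
proof -
  have "(l, l') \<in> snd (snd (A.info i))" using assms by (simp add: A.info_def)
  then show ?thesis unfolding info_\<beta>[OF assms(1)] by (simp add: B.info_def)
qed

lemma identified:
  assumes i: "i < n" and l: "l < A.lev i" "l' < A.lev (Suc i)"
  shows "y i l = y (Suc i) l' \<longleftrightarrow> y' (\<beta> i) l = y' (\<alpha> (Suc i)) l'"
proof -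
  have "(l, l') \<in> snd (snd (A.letter i)) \<longleftrightarrow> (l, l') \<in> snd (snd (B.letter (\<beta> i)))"
    using letter_eq[OF i] by simp
  then show ?thesis
    using l lev_eq[of i] lev_eq[of "Suc i"] i \<alpha>_Suc[OF i] by (simp add: A.letter_def B.letter_def)
qed

text \<open>Both ends of gap \<open>i\<close> carry the parities \<open>par i\<close>, so the sets
  supplied by \<open>B.gap\<close> are all strongly connected.\<close>

lemma gap_sets:
  "\<exists>U. \<forall>i\<le>n. \<forall>l<A.lev i. y' (\<alpha> i) l \<in> U i l \<and> y' (\<beta> i) l \<in> U i l \<and>
     U i l \<subseteq> {v \<in> V'. 1 \<le> S' (\<alpha> i) v \<and> S' (\<beta> i) v \<le> 1} \<and>
     (\<forall>l'<A.lev i. l \<noteq> l' \<longrightarrow> U i l \<inter> U i l' = {}) \<and> strong E' (U i l)"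
proof -
  have "\<exists>U. \<forall>l<A.lev i. y' (\<alpha> i) l \<in> U l \<and> y' (\<beta> i) l \<in> U l \<and>
     U l \<subseteq> {v \<in> V'. 1 \<le> S' (\<alpha> i) v \<and> S' (\<beta> i) v \<le> 1} \<and>
     (\<forall>l'<A.lev i. l \<noteq> l' \<longrightarrow> U l \<inter> U l' = {}) \<and> strong E' (U l)" if i: "i \<le> n" for i
    using B.gap[OF \<alpha>_le_\<beta>[OF i] \<beta>_le[OF i] gap_ends[OF i] gap_lev[OF i]]
    unfolding lev_eq[OF i] par_eq[OF i] by simp
  then show ?thesis by (intro choice) blast
qed

definition U :: "nat \<Rightarrow> nat \<Rightarrow> 'c set" where
  "U = (SOME U. \<forall>i\<le>n. \<forall>l<A.lev i. y' (\<alpha> i) l \<in> U i l \<and> y' (\<beta> i) l \<in> U i l \<and>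
     U i l \<subseteq> {v \<in> V'. 1 \<le> S' (\<alpha> i) v \<and> S' (\<beta> i) v \<le> 1} \<and>
     (\<forall>l'<A.lev i. l \<noteq> l' \<longrightarrow> U i l \<inter> U i l' = {}) \<and> strong E' (U i l))"

lemma U:
  assumes "i \<le> n" "l < A.lev i"
  shows "y' (\<alpha> i) l \<in> U i l" "y' (\<beta> i) l \<in> U i l" "strong E' (U i l)" "U i l \<subseteq> V'"
    and "z \<in> U i l \<Longrightarrow> 1 \<le> S' (\<alpha> i) z" "z \<in> U i l \<Longrightarrow> S' (\<beta> i) z \<le> 1"
    and U_disjoint: "l' < A.lev i \<Longrightarrow> z \<in> U i l \<Longrightarrow> z \<in> U i l' \<Longrightarrow> l = l'"
proof -
  have *: "y' (\<alpha> i) l \<in> U i l \<and> y' (\<beta> i) l \<in> U i l \<and>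
     U i l \<subseteq> {v \<in> V'. 1 \<le> S' (\<alpha> i) v \<and> S' (\<beta> i) v \<le> 1} \<and>
     (\<forall>l'<A.lev i. l \<noteq> l' \<longrightarrow> U i l \<inter> U i l' = {}) \<and> strong E' (U i l)"
    using someI_ex[OF gap_sets, folded U_def] assms by blast
  show "y' (\<alpha> i) l \<in> U i l" "y' (\<beta> i) l \<in> U i l" "strong E' (U i l)" "U i l \<subseteq> V'"
    "z \<in> U i l \<Longrightarrow> 1 \<le> S' (\<alpha> i) z" "z \<in> U i l \<Longrightarrow> S' (\<beta> i) z \<le> 1"
    using * by auto
  show "l' < A.lev i \<Longrightarrow> z \<in> U i l \<Longrightarrow> z \<in> U i l' \<Longrightarrow> l = l'"
    using * by blast
qed

text \<open>The third component of the matched letter says that a label survives the step in one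
  sequence exactly if it does in the other. Here survival is pulled back to the smaller digraph;
  \<open>persist\<close> pushes it forward.\<close>

lemma transfer:
  assumes i: "i < n" and u: "u \<in> A.M i" and z: "y' (\<beta> i) (A.lab i u) \<in> B.M (\<alpha> (Suc i))"
  shows "u \<in> A.M (Suc i)" "y' (\<beta> i) (A.lab i u) = y' (\<alpha> (Suc i)) (A.lab (Suc i) u)"
proof -
  let ?z = "y' (\<beta> i) (A.lab i u)" and ?l = "B.lab (\<alpha> (Suc i)) (y' (\<beta> i) (A.lab i u))"
  have Sn: "Suc i \<le> n" "i \<le> n" using i by auto
  have l: "?l < A.lev (Suc i)" "?z = y' (\<alpha> (Suc i)) ?l"
    using B.lab[OF \<alpha>_le[OF Sn(1)] z] lev_eq[OF Sn(1)] by auto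
  have lu: "A.lab i u < A.lev i" "y i (A.lab i u) = u" using A.lab[OF Sn(2) u] .
  have "y i (A.lab i u) = y (Suc i) ?l" using identified[OF i lu(1) l(1)] l(2) by blast
  then have u': "u = y (Suc i) ?l" using lu by simp
  then show "u \<in> A.M (Suc i)" using A.y_M[OF Sn(1) l(1)] by simp
  have "A.lab (Suc i) u = ?l" using A.lab_y[OF Sn(1) l(1)] u' by simp
  then show "?z = y' (\<alpha> (Suc i)) (A.lab (Suc i) u)" using l(2) by simp
qed

lemma persist:
  assumes i: "i < n" and u: "u \<in> A.M i" "u \<in> A.M (Suc i)"
  shows "y' (\<beta> i) (A.lab i u) = y' (\<alpha> (Suc i)) (A.lab (Suc i) u)"
  using identified[OF i, of "A.lab i u" "A.lab (Suc i) u"] A.lab[of i u] A.lab[of "Suc i" u] i u by auto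

text \<open>The branch set follows the label of \<open>v\<close> through all gaps of its lifetime.
  Consecutive sets share the vertex that survives the matched letter, by \<open>persist\<close>, so
  the union is strongly connected.\<close>

definition \<phi> :: "'a \<Rightarrow> 'c set" where
  "\<phi> v = (\<Union>i\<in>{A.enter v..<A.leave v}. U i (A.lab i v))"

lemma \<phi>_iff: "v \<in> V \<Longrightarrow> z \<in> \<phi> v \<longleftrightarrow> (\<exists>i\<le>n. v \<in> A.M i \<and> z \<in> U i (A.lab i v))"
proof -
  assume v: "v \<in> V"
  have "{A.enter v..<A.leave v} = {i. i \<le> n \<and> v \<in> A.M i}"
    using v A.enter_leave(3)[OF v] A.M_iff[of _ v] by auto
  then show ?thesis by (auto simp: \<phi>_def)
qed

lemma \<phi>_subset: "v \<in> V \<Longrightarrow> \<phi> v \<subseteq> V'"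
  using \<phi>_iff[of v] U(4) A.lab(1) by blast

lemma \<phi>_nonempty: "v \<in> V \<Longrightarrow> \<phi> v \<noteq> {}"
proof -
  assume v: "v \<in> V"
  have n: "A.enter v \<le> n" using A.enter_leave[OF v] by simp
  then have M: "v \<in> A.M (A.enter v)" using A.M_iff v A.enter_leave[OF v] by simp
  show ?thesis using \<phi>_iff[OF v] U(1)[OF n A.lab(1)[OF n M]] n M by blast
qed

lemma \<phi>_strong:
  assumes v: "v \<in> V" shows "strong E' (\<phi> v)"
  unfolding \<phi>_def
proof (rule strong_UN_chain)
  note el = A.enter_leave[OF v]
  show "A.enter v < A.leave v" by (rule el)
  fix i assume i: "A.enter v \<le> i"
  show "strong E' (U i (A.lab i v))" if "i < A.leave v"
    using U(3) A.lab(1)[of i v] A.M_iff[of i v] i el v that by simp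
  show "U i (A.lab i v) \<inter> U (Suc i) (A.lab (Suc i) v) \<noteq> {}" if "Suc i < A.leave v"
  proof -
    have "v \<in> A.M i" "v \<in> A.M (Suc i)" and n: "i < n"
      using A.M_iff[of i v] A.M_iff[of "Suc i" v] i el v that by auto
    then show ?thesis
      using persist[of i v] U(2)[of i "A.lab i v"] U(1)[of "Suc i" "A.lab (Suc i) v"]
        A.lab(1)[of i v] A.lab(1)[of "Suc i" v] by auto
  qed
qed

text \<open>For \<open>i < j\<close> the common vertex \<open>z\<close> is not on the right at
  \<open>\<beta> i\<close> and not on the left at \<open>\<alpha> j\<close>, so it stays in the
  middle all the way. By \<open>transfer\<close> it represents \<open>u\<close> at every position in
  between, up to \<open>\<alpha> j\<close>, and disjointness within gap \<open>j\<close> gives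
  \<open>u = v\<close>.\<close>

lemma gap_sets_disjoint:
  assumes ij: "i \<le> j" "j \<le> n" and u: "u \<in> A.M i" and v: "v \<in> A.M j"
    and z: "z \<in> U i (A.lab i u)" "z \<in> U j (A.lab j v)"
  shows "u = v"
proof (cases "i = j")
  case True
  then have "A.lab j u = A.lab j v"
    using U_disjoint[of j "A.lab j u" "A.lab j v" z] A.lab(1) ij u v z by simp
  then show ?thesis using A.lab(2)[of j u] A.lab(2)[of j v] True ij u v by metis
next
  case False
  then have ij': "i < j" using ij by simp
  have i_n: "i \<le> n" using ij by simp
  have lu: "A.lab i u < A.lev i" using A.lab(1)[OF i_n u] .
  have lv: "A.lab j v < A.lev j" using A.lab(1)[OF ij(2) v] .
  have zV: "z \<in> V'" using U(4)[OF i_n lu] z by blast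
  have zM: "z \<in> B.M p" if p: "\<beta> i \<le> p" "p \<le> \<alpha> j" for p
  proof -
    have "p \<le> n'" using p \<alpha>_le[OF ij(2)] by simp
    then have "S' p z \<le> 1" "1 \<le> S' p z"
      using B.S_antimono[OF p(1), of z] B.S_antimono[OF p(2), of z] U(6)[OF i_n lu z(1)]
        U(5)[OF ij(2) lv z(2)] \<alpha>_le[OF ij(2)] by simp_all
    then show ?thesis using zV by (simp add: middle_def)
  qed
  have \<beta>_hit: "z = y' (\<beta> m) l" if m: "m \<le> n" "l < A.lev m" "z \<in> U m l" "z \<in> B.M (\<beta> m)" for m l
  proof -
    let ?l = "B.lab (\<beta> m) z"
    have "?l < A.lev m" "y' (\<beta> m) ?l = z" using B.lab[OF \<beta>_le[OF m(1)] m(4)] lev_eq[OF m(1)] by auto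
    moreover from this have "z \<in> U m ?l" using U(2)[OF m(1), of ?l] by simp
    ultimately show ?thesis using U_disjoint[OF m(1,2), of ?l z] m by simp
  qed
  have advance: "u \<in> A.M (Suc m) \<and> z = y' (\<alpha> (Suc m)) (A.lab (Suc m) u)"
    if "i \<le> m" "m < j" "u \<in> A.M m" "z = y' (\<beta> m) (A.lab m u)" for m
  proof -
    have "\<alpha> (Suc m) = Suc (\<beta> m)" "\<beta> i \<le> \<beta> m" "Suc (\<beta> m) \<le> \<alpha> j"
      using \<alpha>_Suc[of m] \<beta>_mono[of i m] \<beta>_less_\<alpha>[of m j] that ij by auto
    then have "y' (\<beta> m) (A.lab m u) \<in> B.M (\<alpha> (Suc m))" using zM[of "\<alpha> (Suc m)"] that by simp
    then show ?thesis using transfer[of m u] that ij by simp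
  qed
  have "u \<in> A.M m \<and> z = y' (\<beta> m) (A.lab m u)" if "i \<le> m" "m < j" for m
    using that
  proof (induction m rule: dec_induct)
    case base
    show ?case using \<beta>_hit[OF i_n lu z(1) zM] \<beta>_less_\<alpha>[OF ij' ij(2)] u by simp
  next
    case (step m)
    then have m: "u \<in> A.M (Suc m)" "z = y' (\<alpha> (Suc m)) (A.lab (Suc m) u)"
      using advance[of m] by auto
    have n: "Suc m \<le> n" using step ij by simp
    have l: "A.lab (Suc m) u < A.lev (Suc m)" using A.lab(1)[OF n m(1)] .
    have "z \<in> B.M (\<beta> (Suc m))"
      using zM[of "\<beta> (Suc m)"] \<beta>_mono[of i "Suc m"] \<beta>_less_\<alpha>[of "Suc m" j] step ij by simp
    then show ?case using \<beta>_hit[OF n l] U(1)[OF n l] m by simp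
  qed
  from this[of "j - 1"] have uj: "u \<in> A.M j" and zj: "z = y' (\<alpha> j) (A.lab j u)"
    using advance[of "j - 1"] ij' by simp_all
  note luj = A.lab[OF ij(2) uj]
  have "A.lab j u = A.lab j v"
    using U_disjoint[OF ij(2) luj(1) lv _ z(2)] U(1)[OF ij(2) luj(1)] zj by simp
  then have "y j (A.lab j u) = y j (A.lab j v)" by (rule arg_cong)
  then show ?thesis unfolding luj(2) A.lab(2)[OF ij(2) v] .
qed

lemma \<phi>_disjoint:
  assumes "u \<in> V" "v \<in> V" "u \<noteq> v" shows "\<phi> u \<inter> \<phi> v = {}"
proof (rule ccontr)
  assume "\<phi> u \<inter> \<phi> v \<noteq> {}"
  then obtain z where "z \<in> \<phi> u" "z \<in> \<phi> v" by blast
  then obtain i j where "i \<le> n" "u \<in> A.M i" "z \<in> U i (A.lab i u)"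
    "j \<le> n" "v \<in> A.M j" "z \<in> U j (A.lab j v)"
    unfolding \<phi>_iff[OF assms(1)] \<phi>_iff[OF assms(2)] by (elim exE conjE)
  then have "u = v"
    using gap_sets_disjoint[of i j u v z] gap_sets_disjoint[of j i v u z] by (cases "i \<le> j") auto
  then show False using assms by simp
qed

lemma \<phi>_edge:
  assumes uv: "(u, v) \<in> E" "u \<noteq> v"
  shows "\<exists>a\<in>\<phi> u. \<exists>b\<in>\<phi> v. (a, b) \<in> E'"
proof -
  have V: "u \<in> V" "v \<in> V" using uv A.E_subset by auto
  note u = A.enter_leave[OF V(1)] and v = A.enter_leave[OF V(2)]
  consider i where "i < n" "u \<in> A.M i" "v \<in> A.M i" | "A.leave v < A.enter u"
    using A.edge_cases[OF uv] by blast
  then show ?thesis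
  proof cases
    case 1
    then have "(y' (\<beta> i) (A.lab i u), y' (\<beta> i) (A.lab i v)) \<in> E'"
      using adjacent_\<beta>[of i] A.lab[of i u] A.lab[of i v] uv by simp
    moreover have "y' (\<beta> i) (A.lab i u) \<in> \<phi> u" "y' (\<beta> i) (A.lab i v) \<in> \<phi> v"
      unfolding \<phi>_iff[OF V(1)] \<phi>_iff[OF V(2)]
      using 1 A.lab(1)[of i u] A.lab(1)[of i v] U(2)[of i "A.lab i u"] U(2)[of i "A.lab i v"]
      by (auto intro!: exI[of _ i])
    ultimately show ?thesis by blast
  next
    case 2
    define i where "i = A.leave v - 1"
    define j where "j = A.enter u - 1"
    have ij: "Suc i = A.leave v" "Suc j = A.enter u" "i < n" "j < n" "Suc i \<le> j"
      using 2 u v by (auto simp: i_def j_def)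
    have vM: "v \<in> A.M i" "v \<notin> A.M (Suc i)" and uM: "u \<notin> A.M j" "u \<in> A.M (Suc j)"
      using A.M_iff[of i v] A.M_iff[of "Suc i" v] A.M_iff[of j u] A.M_iff[of "Suc j" u] ij V u v by auto
    have le: "i \<le> n" "Suc i \<le> n" "j \<le> n" "Suc j \<le> n" using ij by auto
    \<comment> \<open>\<open>z\<close> represents \<open>v\<close> just before \<open>v\<close>
      leaves, and \<open>x\<close> represents \<open>u\<close> just after \<open>u\<close> enters.
      At \<open>\<beta> j\<close> they have values 0 and 2, so there is no edge from
      \<open>z\<close> to \<open>x\<close>, and semicompleteness gives the reverse one.\<close>
    define z where "z = y' (\<beta> i) (A.lab i v)"
    define x where "x = y' (\<alpha> (Suc j)) (A.lab (Suc j) u)"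
    note lv = A.lab[OF le(1) vM(1)] and lu = A.lab[OF le(4) uM(2)]
    have z\<phi>: "z \<in> \<phi> v" using \<phi>_iff[OF V(2)] U(2)[OF le(1) lv(1)] le(1) vM by (auto simp: z_def)
    have x\<phi>: "x \<in> \<phi> u" using \<phi>_iff[OF V(1)] U(1)[OF le(4) lu(1)] le(4) uM by (auto simp: x_def)
    have zx: "z \<in> V'" "x \<in> V'" using \<phi>_subset V z\<phi> x\<phi> by auto
    have "S' (\<beta> i) z \<le> 1" using U(6)[OF le(1) lv(1)] U(2)[OF le(1) lv(1)] by (simp add: z_def)
    then have "S' (\<alpha> (Suc i)) z \<le> 1"
      using B.S_antimono[of "\<beta> i" "\<alpha> (Suc i)" z] \<alpha>_Suc[OF ij(3)] \<alpha>_le[OF le(2)] by simp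
    moreover have "z \<notin> B.M (\<alpha> (Suc i))" using transfer(1)[OF ij(3) vM(1)] vM(2) by (auto simp: z_def)
    ultimately have "S' (\<alpha> (Suc i)) z = 0" using zx by (auto simp: middle_def)
    moreover have \<alpha>\<beta>: "\<alpha> (Suc i) \<le> \<beta> j" using \<alpha>_le_\<beta>[OF le(2)] \<beta>_mono[OF ij(5) le(3)] by simp
    ultimately have z0: "S' (\<beta> j) z = 0"
      using B.S_antimono[OF \<alpha>\<beta> \<beta>_le[OF le(3)], of z] by simp
    have "1 \<le> S' (\<alpha> (Suc j)) x" using U(5)[OF le(4) lu(1)] U(1)[OF le(4) lu(1)] by (simp add: x_def)
    then have "1 \<le> S' (\<beta> j) x"
      using B.S_antimono[of "\<beta> j" "\<alpha> (Suc j)" x] \<alpha>_Suc[OF ij(4)] \<alpha>_le[OF le(4)] by simp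
    moreover have "x \<notin> B.M (\<beta> j)"
    proof
      assume "x \<in> B.M (\<beta> j)"
      then have l: "B.lab (\<beta> j) x < A.lev j" "y' (\<beta> j) (B.lab (\<beta> j) x) = x"
        using B.lab[OF \<beta>_le[OF le(3)], of x] lev_eq[OF le(3)] by auto
      then have "y j (B.lab (\<beta> j) x) = u"
        using identified[OF ij(4) l(1) lu(1)] lu(2) by (simp add: x_def)
      then show False using A.y_M[OF le(3) l(1)] uM(1) by simp
    qed
    ultimately have x2: "S' (\<beta> j) x = 2"
      using zx B.S_le_2[OF \<beta>_le[OF le(3)], of x] by (auto simp: middle_def)
    have "(z, x) \<notin> E'" using B.S_jump[OF \<beta>_le[OF le(3)], of z x] z0 x2 by auto
    moreover have "z \<noteq> x" using z0 x2 by auto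
    ultimately have "(x, z) \<in> E'" using B.semicomplete[OF zx] by simp
    then show ?thesis using z\<phi> x\<phi> by blast
  qed
qed

end

section \<open>Words of labelled sequences\<close>

definition rising :: "info \<times> info \<times> (nat \<times> nat) set \<Rightarrow> bool" where
  "rising x \<longleftrightarrow> fst (fst x) < fst (fst (snd x))"

context labelled_sequence
begin

definition word :: "(info \<times> info \<times> (nat \<times> nat) set) list" where "word = map letter [0..<n]"

lemma letter_lev:
  assumes "p < n"
  shows "lev (Suc p) = (if rising (letter p) then lev p + 1 else lev p - 1) \<and>
    (\<not> rising (letter p) \<longrightarrow> 0 < lev p)"
  using lev_step[OF assms] by (auto simp: rising_def letter_def info_def)

lemma dyck_word:
  assumes "\<And>p. p \<le> n \<Longrightarrow> lev p \<le> K"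
  shows "dyck rising K word"
  unfolding word_def
  by (rule dyck_of_levels[where n = n and l = lev and up = rising and w = letter, OF letter_lev]) (use assms in \<open>auto simp: M_0 M_n\<close>)

lemma set_word:
  assumes K: "\<And>p. p \<le> n \<Longrightarrow> lev p \<le> K"
  defines "I \<equiv> {..K} \<times> Pow {..<K} \<times> Pow ({..<K} \<times> {..<K})"
  shows "set word \<subseteq> I \<times> I \<times> Pow ({..<K} \<times> {..<K})"
proof -
  have "info p \<in> I" if "p \<le> n" for p
    using K[OF that] par_subset[OF that] by (fastforce simp: info_def I_def)
  moreover have "snd (snd (letter p)) \<subseteq> {..<K} \<times> {..<K}" if "p < n" for p
    using K[of p] K[of "Suc p"] that by (auto simp: letter_def)
  ultimately have "letter p \<in> I \<times> I \<times> Pow ({..<K} \<times> {..<K})" if "p < n" for p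
    using that by (simp add: mem_Times_iff) (simp add: letter_def)
  then show ?thesis unfolding word_def set_map set_upt by (intro image_subsetI) simp
qed

end

lemma labelled_embedding_of_dyck_emb:
  assumes A: "labelled_sequence V E n S y par" and B: "labelled_sequence V' E' n' S' y' par'"
    and emb: "dyck_emb rising (labelled_sequence.word V E n S y par) (labelled_sequence.word V' E' n' S' y' par')"
  shows "\<exists>\<alpha> \<beta>. labelled_embedding V E n S y par V' E' n' S' y' par' \<alpha> \<beta>"
proof -
  interpret A: labelled_sequence V E n S y par by (rule A)
  interpret B: labelled_sequence V' E' n' S' y' par' by (rule B)
  have len: "length A.word = n" "length B.word = n'" by (simp_all add: A.word_def B.word_def)
  obtain \<alpha> \<beta> where "\<alpha> 0 = 0 \<and> \<beta> n = n' \<and>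
    (\<forall>i < n. \<alpha> (Suc i) = Suc (\<beta> i) \<and> A.word ! i = B.word ! \<beta> i) \<and>
    (\<forall>i \<le> n. \<alpha> i \<le> \<beta> i \<and> \<beta> i \<le> n' \<and>
      (\<exists>h. dyck rising h (take (\<beta> i - \<alpha> i) (drop (\<alpha> i) B.word))))"
    using dyck_emb_positions[OF emb] unfolding len by (elim exE)
  then have pos: "\<alpha> 0 = 0" "\<beta> n = n'"
    "\<And>i. i < n \<Longrightarrow> \<alpha> (Suc i) = Suc (\<beta> i) \<and> A.word ! i = B.word ! \<beta> i"
    "\<And>i. i \<le> n \<Longrightarrow> \<alpha> i \<le> \<beta> i \<and> \<beta> i \<le> n' \<and>
      (\<exists>h. dyck rising h (take (\<beta> i - \<alpha> i) (drop (\<alpha> i) B.word)))"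
    by simp_all
  have lev: "B.lev (\<alpha> i) = B.lev (\<beta> i) \<and> (\<forall>r. \<alpha> i \<le> r \<and> r \<le> \<beta> i \<longrightarrow> B.lev (\<alpha> i) \<le> B.lev r)"
    if i: "i \<le> n" for i
  proof -
    obtain h where h: "dyck rising h (take (\<beta> i - \<alpha> i) (drop (\<alpha> i) B.word))"
      using pos(4)[OF i] by blast
    have "take (\<beta> i - \<alpha> i) (drop (\<alpha> i) B.word) = map B.letter [\<alpha> i..<\<beta> i]"
      using pos(4)[OF i] by (simp add: B.word_def drop_map take_map)
    with h have "dyck rising h (map B.letter [\<alpha> i..<\<beta> i])" by simp
    from dyck_levels[where n = n' and l = B.lev and up = rising and w = B.letter, OF B.letter_lev this]
    show ?thesis using pos(4)[OF i] by blast
  qed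
  have "labelled_embedding V E n S y par V' E' n' S' y' par' \<alpha> \<beta>"
  proof unfold_locales
    show "A.letter i = B.letter (\<beta> i)" if "i < n" for i
    proof -
      have "\<beta> i < n'"
        using pos(3)[OF that] pos(4)[of "Suc i"] that by simp
      then show ?thesis using pos(3)[OF that] that by (simp add: A.word_def B.word_def)
    qed
    show "B.lev (\<alpha> i) \<le> B.lev m" if "i \<le> n" "\<alpha> i \<le> m" "m \<le> \<beta> i" for i m
      using lev[OF that(1)] that(2,3) by blast
  qed (use pos lev in blast)+
  then show ?thesis by blast
qed


section \<open>Contracting branch sets\<close>

lemma rtrancl_on_of_strong:
  assumes "(a, b) \<in> (E \<inter> U \<times> U)\<^sup>*" "a \<in> U" "E \<inter> U \<times> U \<subseteq> E'"
  shows "(a, b) \<in> rtrancl_on U E'"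
  using assms(1)
proof (induction rule: rtrancl_induct)
  case base
  show ?case using assms(2) by (rule rtrancl_on_refl)
next
  case (step y z)
  then have "(y, z) \<in> E'" "z \<in> U" using assms(3) by auto
  with step.IH show ?case by (rule rtrancl_on_into_rtrancl_on)
qed

text \<open>Branch sets are contracted one after another, starting from the subdigraph that keeps
  all arcs inside branch sets but just one further arc for each arc of \<open>H\<close>. All
  deletions thus precede the contractions, as \<open>minor\<close> demands.\<close>

theorem minor_of_model:
  fixes H :: "('c, 'd) pre_digraph" and G :: "('a, 'b) pre_digraph"
  assumes H: "digraph H" and G: "wf_digraph G"
    and sub: "\<And>v. v \<in> verts H \<Longrightarrow> \<phi> v \<subseteq> verts G"
    and ne: "\<And>v. v \<in> verts H \<Longrightarrow> \<phi> v \<noteq> {}"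
    and strong: "\<And>v. v \<in> verts H \<Longrightarrow> strong (arcs_ends G) (\<phi> v)"
    and disj: "\<And>u v. u \<in> verts H \<Longrightarrow> v \<in> verts H \<Longrightarrow> u \<noteq> v \<Longrightarrow> \<phi> u \<inter> \<phi> v = {}"
    and edge: "\<And>u v. (u, v) \<in> arcs_ends H \<Longrightarrow> \<exists>a\<in>\<phi> u. \<exists>b\<in>\<phi> v. (a, b) \<in> arcs_ends G"
  shows "minor H G"
proof -
  interpret H: digraph H by (rule H)
  interpret G: wf_digraph G by (rule G)
  let ?V = "verts H"
  have same: "u = v" if "x \<in> \<phi> u" "x \<in> \<phi> v" "u \<in> ?V" "v \<in> ?V" for x u v
    using disj that by blast
  define r where "r v = (SOME x. x \<in> \<phi> v)" for v
  have r: "r v \<in> \<phi> v" if "v \<in> ?V" for v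
    using ne[OF that] unfolding r_def by (simp add: some_in_eq)
  have "\<exists>f. f \<in> arcs G \<and> tail G f \<in> \<phi> (tail H e) \<and> head G f \<in> \<phi> (head H e)" if "e \<in> arcs H" for e
  proof -
    have "(tail H e, head H e) \<in> arcs_ends H" using that by (auto simp: arcs_ends_def arc_to_ends_def)
    then show ?thesis using edge by (fastforce simp: arcs_ends_def arc_to_ends_def)
  qed
  then obtain \<eta> where \<eta>: "\<And>e. e \<in> arcs H \<Longrightarrow> \<eta> e \<in> arcs G"
    "\<And>e. e \<in> arcs H \<Longrightarrow> tail G (\<eta> e) \<in> \<phi> (tail H e)"
    "\<And>e. e \<in> arcs H \<Longrightarrow> head G (\<eta> e) \<in> \<phi> (head H e)"
    by metis
  have inj: "inj_on \<eta> (arcs H)"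
  proof (rule inj_onI)
    fix e f assume ef: "e \<in> arcs H" "f \<in> arcs H" "\<eta> e = \<eta> f"
    have "tail H e = tail H f"
      using same[OF \<eta>(2)[OF ef(1)], of "tail H f"] \<eta>(2)[OF ef(2)] ef by simp
    moreover have "head H e = head H f"
      using same[OF \<eta>(3)[OF ef(1)], of "head H f"] \<eta>(3)[OF ef(2)] ef by simp
    ultimately show "e = f" using H.no_multi_arcs ef by (simp add: arc_to_ends_def)
  qed
  define inner where "inner v = {f \<in> arcs G. tail G f \<in> \<phi> v \<and> head G f \<in> \<phi> v}" for v
  have \<eta>_inner: "\<eta> e \<notin> inner v" if "e \<in> arcs H" "v \<in> ?V" for e v
  proof
    assume "\<eta> e \<in> inner v"
    then have "tail H e = v" "head H e = v"
      using same \<eta>(2,3)[OF that(1)] that by (auto simp: inner_def)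
    then show False using H.no_loops[OF that(1)] by simp
  qed
  define \<rho> where "\<rho> F x = (if \<exists>v\<in>F. x \<in> \<phi> v then r (THE v. v \<in> F \<and> x \<in> \<phi> v) else x)" for F x
  have \<rho>_in: "\<rho> F x = r v" if "v \<in> F" "F \<subseteq> ?V" "x \<in> \<phi> v" for F x v
  proof -
    have "(THE v. v \<in> F \<and> x \<in> \<phi> v) = v" using that same by (intro the_equality) blast+
    then show ?thesis using that by (auto simp: \<rho>_def)
  qed
  have \<rho>_out: "\<rho> F x = x" if "\<And>v. v \<in> F \<Longrightarrow> x \<notin> \<phi> v" for F x
    using that by (auto simp: \<rho>_def)
  \<comment> \<open>The stage at which the branch sets of \<open>F\<close> have been contracted to
    their representatives: \<open>C {}\<close> is the initial subdigraph, and the stage for all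
    vertices is a copy of \<open>H\<close>.\<close>
  define C :: "'c set \<Rightarrow> ('a, 'b) pre_digraph" where
    "C F = \<lparr>verts = (\<Union>v\<in>?V - F. \<phi> v) \<union> r ` F, arcs = (\<Union>v\<in>?V - F. inner v) \<union> \<eta> ` arcs H,
      tail = \<lambda>f. \<rho> F (tail G f), head = \<lambda>f. \<rho> F (head G f)\<rparr>" for F
  have \<rho>_verts: "\<rho> F x \<in> verts (C F)" if "v \<in> ?V" "x \<in> \<phi> v" "F \<subseteq> ?V" for F v x
  proof (cases "v \<in> F")
    case True
    then show ?thesis using \<rho>_in[OF True that(3,2)] by (simp add: C_def)
  next
    case False
    then have "\<rho> F x = x" using same that by (intro \<rho>_out) blast
    then show ?thesis using False that by (auto simp: C_def)
  qed
  have wf: "wf_digraph (C F)" if F: "F \<subseteq> ?V" for F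
  proof
    fix f assume f: "f \<in> arcs (C F)"
    then consider v where "v \<in> ?V" "tail G f \<in> \<phi> v" "head G f \<in> \<phi> v"
      | e where "e \<in> arcs H" "f = \<eta> e"
      by (auto simp: C_def inner_def)
    then have "\<exists>u\<in>?V. \<exists>v\<in>?V. tail G f \<in> \<phi> u \<and> head G f \<in> \<phi> v"
    proof cases
      case 2
      then show ?thesis using \<eta>(2,3)[OF 2(1)] H.tail_in_verts[OF 2(1)] H.head_in_verts[OF 2(1)] by blast
    qed blast
    then obtain u v where "u \<in> ?V" "v \<in> ?V" "tail G f \<in> \<phi> u" "head G f \<in> \<phi> v" by blast
    then have "\<rho> F (tail G f) \<in> verts (C F)" "\<rho> F (head G f) \<in> verts (C F)"
      using \<rho>_verts F by blast+
    then show "tail (C F) f \<in> verts (C F)" "head (C F) f \<in> verts (C F)"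
      by (simp_all add: C_def)
  qed
  have "contracts_to (C {}) (C F)" if "finite F" "F \<subseteq> ?V" for F
    using that
  proof (induction F rule: finite_induct)
    case empty
    show ?case by (rule contracts_to.refl)
  next
    case (insert v F)
    then have v: "v \<in> ?V" and vF: "v \<notin> F" and F: "F \<subseteq> ?V" by auto
    \<comment> \<open>The incidence functions are those of the current stage, as a subgraph
      requires; on \<open>\<phi> v\<close>, which is not contracted yet, they agree with those of
      \<open>G\<close>.\<close>
    define S where "S = \<lparr>verts = \<phi> v, arcs = inner v, tail = tail (C F), head = head (C F)\<rparr>"
    have \<rho>v: "\<rho> F x = x" if "x \<in> \<phi> v" for x
      using same[OF that _ v] F vF by (intro \<rho>_out) blast
    have "wf_digraph S"
      by unfold_locales (auto simp: S_def C_def inner_def \<rho>v)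
    moreover have "verts S \<subseteq> verts (C F)" "arcs S \<subseteq> arcs (C F)"
      using v vF by (auto simp: S_def C_def)
    ultimately have subS: "subgraph S (C F)"
      using wf[OF F] by (simp add: subgraph_def compatible_def S_def)
    have ends: "arcs_ends G \<inter> \<phi> v \<times> \<phi> v \<subseteq> arcs_ends S"
    proof
      fix p assume "p \<in> arcs_ends G \<inter> \<phi> v \<times> \<phi> v"
      then obtain f where f: "f \<in> inner v" "p = (tail G f, head G f)"
        by (auto simp: arcs_ends_def arc_to_ends_def inner_def)
      then have "p = arc_to_ends S f" by (simp add: S_def C_def arc_to_ends_def inner_def \<rho>v)
      then show "p \<in> arcs_ends S" using f(1) by (simp add: arcs_ends_def S_def)
    qed
    have strS: "strongly_connected S"
      unfolding strongly_connected_def reachable_def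
      using ne[OF v] strong[OF v] rtrancl_on_of_strong[OF _ _ ends]
      by (auto simp: S_def strong_def)
    have rv: "r v \<in> verts S" using r[OF v] by (simp add: S_def)
    have "contract (C F) S (r v) = C (insert v F)"
    proof -
      have rF: "r ` F \<inter> \<phi> v = {}" using r same v vF F by blast
      have "insert (r v) (verts (C F) - verts S) = verts (C (insert v F))"
      proof -
        have "(\<Union>w\<in>?V - F. \<phi> w) - \<phi> v = (\<Union>w\<in>?V - insert v F. \<phi> w)"
          using same v by blast
        then show ?thesis using rF by (auto simp: C_def S_def)
      qed
      moreover have "arcs (C F) - arcs S = arcs (C (insert v F))"
      proof -
        have "(\<Union>w\<in>?V - F. inner w) - inner v = (\<Union>w\<in>?V - insert v F. inner w)"
          using same v unfolding inner_def by blast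
        moreover have "\<eta> ` arcs H \<inter> inner v = {}" using \<eta>_inner v by blast
        ultimately show ?thesis by (auto simp: C_def S_def)
      qed
      moreover have "(if \<rho> F x \<in> \<phi> v then r v else \<rho> F x) = \<rho> (insert v F) x" for x
      proof -
        consider "x \<in> \<phi> v" | w where "w \<in> F" "x \<in> \<phi> w" | "\<And>w. w \<in> insert v F \<Longrightarrow> x \<notin> \<phi> w"
          by blast
        then show ?thesis
        proof cases
          case 1
          then show ?thesis using \<rho>v \<rho>_in[of v "insert v F" x] v F by simp
        next
          case 2
          then show ?thesis
            using \<rho>_in[OF 2(1) F 2(2)] \<rho>_in[of w "insert v F" x] rF v F by auto
        next
          case 3
          then show ?thesis using \<rho>_out[of F x] \<rho>_out[of "insert v F" x] by simp
        qed
      qed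
      ultimately show ?thesis by (simp add: contract_def S_def C_def cong: if_cong)
    qed
    moreover have "contracts_to (C {}) (contract (C F) S (r v))"
      using insert.IH F subS strS rv by (intro contracts_to.step) auto
    ultimately show ?case by simp
  qed
  then have con: "contracts_to (C {}) (C ?V)" by simp
  have "subgraph (C {}) G"
  proof -
    have "verts (C {}) \<subseteq> verts G" using sub by (auto simp: C_def)
    moreover have "arcs (C {}) \<subseteq> arcs G" using \<eta>(1) by (auto simp: C_def inner_def)
    moreover have "compatible G (C {})" by (auto simp: compatible_def C_def \<rho>_def)
    ultimately show ?thesis using wf[of "{}"] G by (simp add: subgraph_def)
  qed
  moreover have "digraph_iso (C ?V) H"
  proof -
    have rinj: "inj_on r ?V"
    proof (rule inj_onI)
      fix u v assume "u \<in> ?V" "v \<in> ?V" "r u = r v"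
      then show "u = v" using same[of "r u" u v] r by metis
    qed
    have V: "verts (C ?V) = r ` ?V" and A: "arcs (C ?V) = \<eta> ` arcs H" by (auto simp: C_def)
    define h where "h = \<lparr>iso_verts = the_inv_into ?V r, iso_arcs = the_inv_into (arcs H) \<eta>,
      iso_head = head H, iso_tail = tail H\<rparr>"
    have "pre_digraph.digraph_isomorphism (C ?V) h"
      unfolding pre_digraph.digraph_isomorphism_def
    proof (intro conjI ballI)
      show "wf_digraph (C ?V)" by (rule wf) simp
      show "inj_on (iso_verts h) (verts (C ?V))" "inj_on (iso_arcs h) (arcs (C ?V))"
        using rinj inj by (auto simp: h_def V A intro: inj_on_the_inv_into)
      fix f assume "f \<in> arcs (C ?V)"
      then obtain e where e: "e \<in> arcs H" "f = \<eta> e" by (auto simp: A)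
      have "tail (C ?V) f = r (tail H e)" "head (C ?V) f = r (head H e)"
        using \<rho>_in[of "tail H e" ?V "tail G f"] \<rho>_in[of "head H e" ?V "head G f"] \<eta>(2,3)[OF e(1)] e
        by (simp_all add: C_def)
      then show "iso_verts h (tail (C ?V) f) = iso_tail h (iso_arcs h f)"
        "iso_verts h (head (C ?V) f) = iso_head h (iso_arcs h f)"
        using e by (simp_all add: h_def the_inv_into_f_f[OF rinj] the_inv_into_f_f[OF inj])
    qed
    moreover have "H = app_iso h (C ?V)"
      by (simp add: app_iso_def V A h_def the_inv_into_onto[OF rinj] the_inv_into_onto[OF inj])
    ultimately show ?thesis unfolding digraph_iso_def by blast
  qed
  ultimately show ?thesis using con unfolding minor_def by blast
qed


section \<open>The theorem\<close>

lemma labelled_sequence_exists: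
  fixes G :: "('a, 'b) pre_digraph"
  assumes G: "semicomplete_digraph G" and pw: "path_width_at_most G k"
  shows "\<exists>n S y par. labelled_sequence (verts G) (arcs_ends G) n S y par \<and>
    (\<forall>p\<le>n. card (middle (verts G) (S p)) \<le> Suc k)"
proof -
  interpret semicomplete_digraph G by (rule G)
  have EV: "arcs_ends G \<subseteq> verts G \<times> verts G" by (auto simp: arcs_ends_def arc_to_ends_def)
  obtain xs0 where "sep_chain (verts G) (arcs_ends G) (Suc k) xs0"
    using path_decomposition_sep_chain[OF wf_digraph finite_verts pw] by blast
  then obtain xs where xs: "sep_chain (verts G) (arcs_ends G) (Suc k) xs"
    "successively (step (verts G)) xs" "linked (verts G) (arcs_ends G) xs"
    by (rule linked_sep_chain[OF finite_verts])
  have "linked_sequence (verts G) (arcs_ends G) (length xs - 1) (\<lambda>p. xs ! p)"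
    by (rule linked_sequence_of_sep_chain[OF finite_verts EV semicomplete xs])
  then obtain y par where
    "labelled_sequence (verts G) (arcs_ends G) (length xs - 1) (\<lambda>p. xs ! p) y par"
    using linked_sequence.labelling_exists by blast
  moreover have "card (middle (verts G) (xs ! p)) \<le> Suc k" if "p \<le> length xs - 1" for p
  proof -
    have "0 < length xs" using xs(1) by (simp add: sep_chain_def)
    then have "xs ! p \<in> set xs" using that by (intro nth_mem) linarith
    then show ?thesis using xs(1) by (simp add: sep_chain_def)
  qed
  ultimately show ?thesis by blast
qed

theorem mainTheorem5:
  fixes k :: nat and G :: "nat \<Rightarrow> ('a, 'b) pre_digraph"
  assumes "\<And>n. semicomplete_digraph (G n)"
    and "\<And>n. path_width_at_most (G n) k"
  shows "\<exists>i j. i < j \<and> minor (G i) (G j)"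
proof -
  \<comment> \<open>Bags have at most \<open>Suc k\<close> vertices, so all orders are at most
    \<open>Suc k\<close> and all labels are below it. This makes the alphabet finite and bounds the
    height of the words.\<close>
  define I :: "info set" where "I = {..Suc k} \<times> Pow {..<Suc k} \<times> Pow ({..<Suc k} \<times> {..<Suc k})"
  let ?A = "I \<times> I \<times> Pow ({..<Suc k} \<times> {..<Suc k})"
  have "\<exists>w. w \<in> {w. dyck rising (Suc k) w \<and> set w \<subseteq> ?A} \<and>
    (\<exists>n S y par. labelled_sequence (verts (G m)) (arcs_ends (G m)) n S y par \<and>
      w = labelled_sequence.word (verts (G m)) (arcs_ends (G m)) n S y par)" for m
  proof -
    obtain n S y par where seq: "labelled_sequence (verts (G m)) (arcs_ends (G m)) n S y par"
      and bound: "\<And>p. p \<le> n \<Longrightarrow> card (middle (verts (G m)) (S p)) \<le> Suc k"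
      using labelled_sequence_exists[OF assms(1,2)] by blast
    let ?w = "labelled_sequence.word (verts (G m)) (arcs_ends (G m)) n S y par"
    have "dyck rising (Suc k) ?w" "set ?w \<subseteq> ?A"
      using labelled_sequence.dyck_word[OF seq bound] labelled_sequence.set_word[OF seq bound]
      unfolding I_def by auto
    with seq show ?thesis by blast
  qed
  then have "\<exists>w. \<forall>m. w m \<in> {w. dyck rising (Suc k) w \<and> set w \<subseteq> ?A} \<and>
    (\<exists>n S y par. labelled_sequence (verts (G m)) (arcs_ends (G m)) n S y par \<and>
      w m = labelled_sequence.word (verts (G m)) (arcs_ends (G m)) n S y par)"
    by (intro choice allI)
  then obtain w where w_seq: "\<forall>m. w m \<in> {w. dyck rising (Suc k) w \<and> set w \<subseteq> ?A} \<and>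
    (\<exists>n S y par. labelled_sequence (verts (G m)) (arcs_ends (G m)) n S y par \<and>
      w m = labelled_sequence.word (verts (G m)) (arcs_ends (G m)) n S y par)"
    by (elim exE)
  note w = conjunct1[OF spec[OF w_seq]] and seq = conjunct2[OF spec[OF w_seq]]
  have "finite ?A" by (simp add: I_def)
  then have "almost_full_on (dyck_emb rising) {w. dyck rising (Suc k) w \<and> set w \<subseteq> ?A}"
    by (rule almost_full_on_dyck_emb)
  then obtain i j where ij: "i < j" and emb: "dyck_emb rising (w i) (w j)"
    using almost_full_onD[of _ _ w] w by blast
  obtain n S y par where A: "labelled_sequence (verts (G i)) (arcs_ends (G i)) n S y par"
    and wi: "w i = labelled_sequence.word (verts (G i)) (arcs_ends (G i)) n S y par"
    using seq[of i] by blast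
  obtain n' S' y' par' where B: "labelled_sequence (verts (G j)) (arcs_ends (G j)) n' S' y' par'"
    and wj: "w j = labelled_sequence.word (verts (G j)) (arcs_ends (G j)) n' S' y' par'"
    using seq[of j] by blast
  obtain \<alpha> \<beta> where "labelled_embedding (verts (G i)) (arcs_ends (G i)) n S y par
      (verts (G j)) (arcs_ends (G j)) n' S' y' par' \<alpha> \<beta>"
    using labelled_embedding_of_dyck_emb[OF A B] emb unfolding wi wj by blast
  then interpret labelled_embedding "verts (G i)" "arcs_ends (G i)" n S y par
    "verts (G j)" "arcs_ends (G j)" n' S' y' par' \<alpha> \<beta> .
  interpret H: semicomplete_digraph "G i" by (rule assms)
  interpret J: semicomplete_digraph "G j" by (rule assms)
  have "minor (G i) (G j)"
  proof (rule minor_of_model[OF H.digraph_axioms J.wf_digraph])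
    fix u v assume uv: "(u, v) \<in> arcs_ends (G i)"
    then have "u \<noteq> v" using H.no_loops by (auto simp: arcs_ends_def arc_to_ends_def)
    with uv show "\<exists>a\<in>\<phi> u. \<exists>b\<in>\<phi> v. (a, b) \<in> arcs_ends (G j)" by (rule \<phi>_edge)
  qed (fact \<phi>_subset \<phi>_nonempty \<phi>_strong \<phi>_disjoint)+
  with ij show ?thesis by blast
qed

end
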